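(* Let $I$ be a directed set and let $\mathfrak{F}\equiv(X_i,\mathcal{B}_i,\mu_i,\pi_{ij})$ be a convergent diagram in $\mathfrak{M}$ indexed by $I$, with limit $(X_\infty,\mathcal{B}_\infty,\mu_\infty,\pi_i)$. Then for each $1\le p<\infty$ the cocone $(\mathscr{L}^p(\mathfrak{F}),\psi_i)$ is a realization of the colimit in $\mathfrak{Ban}$ of the codiagram $(L^p(X_i,\mu_i),\pi_{ij}^* )$.
   Context: A directed set is a nonempty set $I$ with a reflexive and transitive relation $\le$ such that any two elements have a common upper bound. $\mathfrak{M}$ is the category of probability spaces and measure preserving measurable maps. A diagram in $\mathfrak{M}$ indexed by $I$ is a family $(X_i,\mathcal{B}_i,\mu_i,\pi_{ij})$ of probability spaces and measure preserving maps $\pi_{ij}:X_j\to X_i$ for $i\le j$ (i.e. $(\pi_{ij})_*\mu_j=\mu_i$), with $\pi_{ii}=\mathrm{id}$ and $\pi_{ik}=\pi_{ij}\circ\pi_{jk}$ for $i\le j\le k$. Put $X_\infty=\{(x_i)_{i}\in\prod_{i\in I}X_i:\pi_{ij}(x_j)=x_i\text{ for all }i\le j\}$, let $\pi_j:X_\infty\to X_j$ be the coordinate projections, and $\mathcal{B}_\infty=\sigma(\{\pi_i^{-1}(B):B\in\mathcal{B}_i,\ i\in I\})$. The diagram is convergent if there is a measure $\mu_\infty$ on $(X_\infty,\mathcal{B}_\infty)$ with $(\pi_i)_*\mu_\infty=\mu_i$ for every $i$; then $(X_\infty,\mathcal{B}_\infty,\mu_\infty,\pi_i)$ is its limit. $L^p$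 denotes spaces of real-valued functions, and $\pi_{ij}^*(u)=u\circ\pi_{ij}$. A family $(f_i)_{i\in I}\in\prod_{i\in I}L^p(X_i,\mu_i)$ is co-Cauchy if for every $\varepsilon>0$ there is $\ell\in I$ with $\|\pi_{ij}^*(f_i)-f_j\|_{L^p(\mu_j)}<\varepsilon$ for all $\ell\le i\le j$. $\mathscr{L}^p(\mathfrak{F})$ is the vector space of co-Cauchy families modulo $(f_i)\sim(g_i)$ iff $\lim_{i\in I}\|f_i-g_i\|_{L^p(\mu_i)}=0$ (net limit), with norm $\|(f_i)_{i\in I}\|_{\mathscr{L}}=\lim_{i\in I}\|f_i\|_{L^p(\mu_i)}$ (net limit). The maps $\psi_i:L^p(X_i,\mu_i)\to\mathscr{L}^p(\mathfrak{F})$ send $f_i$ to (the class of) the family $(h_j)_{j\in I}$ with $h_j=\pi_{ij}^*(f_i)$ if $i\le j$ and $h_j=0$ otherwise. $\mathfrak{Ban}$ is the category of Banach spaces with linear isometries (not necessarily surjective) as morphisms. A codiagram in $\mathfrak{Ban}$ indexed by $I$ is a family $(Z_i,\varphi_{ij})$ of Banach spaces and linear isometries $\varphi_{ij}:Z_i\to Z_j$ ($i\le j$) with $\varphi_{ii}=\mathrm{id}$, $\varphi_{ik}=\varphi_{jk}\circ\varphi_{ij}$. A cocone is a pair $(Y,\psi_i)$ of a Banach space and linear isometries $\psi_i:Z_i\to Y$ with $\psi_i=\psi_j\circ\varphi_{ij}$ for $i\le j$. It is a realization of the colimit if for every cocone $(Y',\rho_i)$ there is a unique linear isometry $\varphi:Y\to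 Y'$ with $\varphi\circ\psi_i=\rho_i$ for all $i$. *)

theory Defs
  imports "HOL-Probability.Probability" "HOL-Algebra.Module"
begin

section \<open>Directed sets and net limits\<close>

definition directed_set :: "'i set \<Rightarrow> ('i \<Rightarrow> 'i \<Rightarrow> bool) \<Rightarrow> bool" where
  "directed_set I leq \<longleftrightarrow>
     I \<noteq> {} \<and> reflp_on I leq \<and> transp_on I leq \<and>
     (\<forall>i\<in>I. \<forall>j\<in>I. \<exists>k\<in>I. leq i k \<and> leq j k)"

definition net_filter :: "'i set \<Rightarrow> ('i \<Rightarrow> 'i \<Rightarrow> bool) \<Rightarrow> 'i filter" where
  "net_filter I leq = (INF i\<in>I. principal {j \<in> I. leq i j})"

lemma eventually_net_filter:
  assumes "directed_set I leq"
  shows "eventually P (net_filter I leq) \<longleftrightarrow> (\<exists>i\<in>I. \<forall>j\<in>I. leq i j \<longrightarrow> P j)"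
proof -
  have "\<exists>k\<in>I. {l \<in> I. leq k l} \<subseteq> {l \<in> I. leq i l} \<inter> {l \<in> I. leq j l}"
    if ij: "i \<in> I" "j \<in> I" for i j
  proof -
    obtain k where k: "k \<in> I" "leq i k" "leq j k"
      using assms ij unfolding directed_set_def by blast
    have "transp_on I leq" using assms unfolding directed_set_def by blast
    then have "{l \<in> I. leq k l} \<subseteq> {l \<in> I. leq i l} \<inter> {l \<in> I. leq j l}"
      using ij k by (auto dest: transp_onD)
    with k(1) show ?thesis by blast
  qed
  moreover have "I \<noteq> {}" using assms unfolding directed_set_def by blast
  ultimately show ?thesis
    unfolding net_filter_def
    by (subst eventually_INF_base) (auto simp: eventually_principal)
qed


section \<open>Banach spaces with linear isometries\<close>

text \<open>Banach spaces are given with an explicit carrier, since the objects of a codiagram depend on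
  the index. The fields \<open>mult\<close> and \<open>one\<close> inherited from \<open>module\<close> play no role.\<close>

record 'v normed = "(real, 'v) module" +
  nrm :: "'v \<Rightarrow> real" ("\<parallel>_\<parallel>\<index>")

definition real_ring :: "real ring" where
  "real_ring = \<lparr>carrier = UNIV, mult = (*), one = 1, zero = 0, add = (+)\<rparr>"

locale normed_space = Module.module real_ring V
  for V :: "'v normed" (structure) +
  assumes nrm_eq_0_iff: "x \<in> carrier V \<Longrightarrow> \<parallel>x\<parallel> = 0 \<longleftrightarrow> x = \<zero>"
    and nrm_smult: "x \<in> carrier V \<Longrightarrow> \<parallel>a \<odot> x\<parallel> = \<bar>a\<bar> * \<parallel>x\<parallel>"
    and nrm_triangle: "x \<in> carrier V \<Longrightarrow> y \<in> carrier V \<Longrightarrow> \<parallel>x \<oplus> y\<parallel> \<le> \<parallel>x\<parallel> + \<parallel>y\<parallel>"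

text \<open>\<open>Metric_space\<close> requires symmetry and nonnegativity also outside the carrier,
  hence the case distinction.\<close>

definition nrm_dist :: "'v normed \<Rightarrow> 'v \<Rightarrow> 'v \<Rightarrow> real" where
  "nrm_dist V x y = (if x \<in> carrier V \<and> y \<in> carrier V then \<parallel>x \<ominus>\<^bsub>V\<^esub> y\<parallel>\<^bsub>V\<^esub> else 0)"

locale banach_space = normed_space +
  assumes complete: "Metric_space.mcomplete (carrier V) (nrm_dist V)"

definition linear_isometry :: "'v normed \<Rightarrow> 'w normed \<Rightarrow> ('v \<Rightarrow> 'w) \<Rightarrow> bool" where
  "linear_isometry V W f \<longleftrightarrow>
     f \<in> carrier V \<rightarrow> carrier W \<and>
     (\<forall>x\<in>carrier V. \<forall>y\<in>carrier V. f (x \<oplus>\<^bsub>V\<^esub> y) = f x \<oplus>\<^bsub>W\<^esub> f y) \<and>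
     (\<forall>a. \<forall>x\<in>carrier V. f (a \<odot>\<^bsub>V\<^esub> x) = a \<odot>\<^bsub>W\<^esub> f x) \<and>
     (\<forall>x\<in>carrier V. \<parallel>f x\<parallel>\<^bsub>W\<^esub> = \<parallel>x\<parallel>\<^bsub>V\<^esub>)"

definition ban_codiagram ::
  "'i set \<Rightarrow> ('i \<Rightarrow> 'i \<Rightarrow> bool) \<Rightarrow> ('i \<Rightarrow> 'z normed) \<Rightarrow> ('i \<Rightarrow> 'i \<Rightarrow> 'z \<Rightarrow> 'z) \<Rightarrow> bool" where
  "ban_codiagram I leq Z \<phi> \<longleftrightarrow>
     (\<forall>i\<in>I. banach_space (Z i)) \<and>
     (\<forall>i\<in>I. \<forall>j\<in>I. leq i j \<longrightarrow> linear_isometry (Z i) (Z j) (\<phi> i j)) \<and>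
     (\<forall>i\<in>I. \<forall>z\<in>carrier (Z i). \<phi> i i z = z) \<and>
     (\<forall>i\<in>I. \<forall>j\<in>I. \<forall>k\<in>I. leq i j \<longrightarrow> leq j k \<longrightarrow>
        (\<forall>z\<in>carrier (Z i). \<phi> i k z = \<phi> j k (\<phi> i j z)))"

definition ban_cocone ::
  "'i set \<Rightarrow> ('i \<Rightarrow> 'i \<Rightarrow> bool) \<Rightarrow> ('i \<Rightarrow> 'z normed) \<Rightarrow> ('i \<Rightarrow> 'i \<Rightarrow> 'z \<Rightarrow> 'z) \<Rightarrow>
   'y normed \<Rightarrow> ('i \<Rightarrow> 'z \<Rightarrow> 'y) \<Rightarrow> bool" where
  "ban_cocone I leq Z \<phi> Y \<psi> \<longleftrightarrow>
     banach_space Y \<and>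
     (\<forall>i\<in>I. linear_isometry (Z i) Y (\<psi> i)) \<and>
     (\<forall>i\<in>I. \<forall>j\<in>I. leq i j \<longrightarrow> (\<forall>z\<in>carrier (Z i). \<psi> i z = \<psi> j (\<phi> i j z)))"

text \<open>The first argument fixes the type in which the competing cocones live; a theorem with this
  type variable free expresses the universal property with respect to all cocones. Maps are
  compared on carriers, so uniqueness is stated among extensional functions.\<close>

definition ban_colimit ::
  "'w itself \<Rightarrow> 'i set \<Rightarrow> ('i \<Rightarrow> 'i \<Rightarrow> bool) \<Rightarrow> ('i \<Rightarrow> 'z normed) \<Rightarrow> ('i \<Rightarrow> 'i \<Rightarrow> 'z \<Rightarrow> 'z) \<Rightarrow>
   'y normed \<Rightarrow> ('i \<Rightarrow> 'z \<Rightarrow> 'y) \<Rightarrow> bool" where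
  "ban_colimit _ I leq Z \<phi> Y \<psi> \<longleftrightarrow>
     ban_codiagram I leq Z \<phi> \<and> ban_cocone I leq Z \<phi> Y \<psi> \<and>
     (\<forall>(Y' :: 'w normed) \<rho>. ban_cocone I leq Z \<phi> Y' \<rho> \<longrightarrow>
        (\<exists>!\<Phi>. \<Phi> \<in> carrier Y \<rightarrow>\<^sub>E carrier Y' \<and> linear_isometry Y Y' \<Phi> \<and>
              (\<forall>i\<in>I. \<forall>z\<in>carrier (Z i). \<Phi> (\<psi> i z) = \<rho> i z)))"


section \<open>Diagrams of probability spaces and their limits\<close>

definition measure_preserving :: "'a measure \<Rightarrow> 'b measure \<Rightarrow> ('a \<Rightarrow> 'b) \<Rightarrow> bool" where
  "measure_preserving M N f \<longleftrightarrow> f \<in> M \<rightarrow>\<^sub>M N \<and> distr M N f = N"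

text \<open>All \<open>X i\<close> have points in one type \<open>'a\<close>; for an arbitrary family take the disjoint union of the
  point sets. Identities between the \<open>\<pi> i j\<close> are only required on the spaces.\<close>

definition prob_diagram ::
  "'i set \<Rightarrow> ('i \<Rightarrow> 'i \<Rightarrow> bool) \<Rightarrow> ('i \<Rightarrow> 'a measure) \<Rightarrow> ('i \<Rightarrow> 'i \<Rightarrow> 'a \<Rightarrow> 'a) \<Rightarrow> bool" where
  "prob_diagram I leq X \<pi> \<longleftrightarrow>
     (\<forall>i\<in>I. prob_space (X i)) \<and>
     (\<forall>i\<in>I. \<forall>j\<in>I. leq i j \<longrightarrow> measure_preserving (X j) (X i) (\<pi> i j)) \<and>
     (\<forall>i\<in>I. \<forall>x\<in>space (X i). \<pi> i i x = x) \<and>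
     (\<forall>i\<in>I. \<forall>j\<in>I. \<forall>k\<in>I. leq i j \<longrightarrow> leq j k \<longrightarrow>
        (\<forall>x\<in>space (X k). \<pi> i k x = \<pi> i j (\<pi> j k x)))"

definition limit_space ::
  "'i set \<Rightarrow> ('i \<Rightarrow> 'i \<Rightarrow> bool) \<Rightarrow> ('i \<Rightarrow> 'a measure) \<Rightarrow> ('i \<Rightarrow> 'i \<Rightarrow> 'a \<Rightarrow> 'a) \<Rightarrow>
   ('i \<Rightarrow> 'a) set" where
  "limit_space I leq X \<pi> =
     {x \<in> (\<Pi>\<^sub>E i\<in>I. space (X i)). \<forall>i\<in>I. \<forall>j\<in>I. leq i j \<longrightarrow> \<pi> i j (x j) = x i}"

definition limit_sets ::
  "'i set \<Rightarrow> ('i \<Rightarrow> 'i \<Rightarrow> bool) \<Rightarrow> ('i \<Rightarrow> 'a measure) \<Rightarrow> ('i \<Rightarrow> 'i \<Rightarrow> 'a \<Rightarrow> 'a) \<Rightarrow>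
   ('i \<Rightarrow> 'a) set set" where
  "limit_sets I leq X \<pi> =
     sigma_sets (limit_space I leq X \<pi>)
       {(\<lambda>x. x i) -` B \<inter> limit_space I leq X \<pi> | i B. i \<in> I \<and> B \<in> sets (X i)}"

definition diagram_limit ::
  "'i set \<Rightarrow> ('i \<Rightarrow> 'i \<Rightarrow> bool) \<Rightarrow> ('i \<Rightarrow> 'a measure) \<Rightarrow> ('i \<Rightarrow> 'i \<Rightarrow> 'a \<Rightarrow> 'a) \<Rightarrow>
   ('i \<Rightarrow> 'a) measure \<Rightarrow> bool" where
  "diagram_limit I leq X \<pi> M \<longleftrightarrow>
     space M = limit_space I leq X \<pi> \<and> sets M = limit_sets I leq X \<pi> \<and>
     (\<forall>i\<in>I. distr M (X i) (\<lambda>x. x i) = X i)"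


section \<open>The spaces \<open>L\<^sup>p\<close>\<close>

definition quotient_space :: "'v normed \<Rightarrow> 'v rel \<Rightarrow> 'v set normed" where
  "quotient_space V r =
     \<lparr>carrier = carrier V // r,
      mult = undefined, one = undefined,
      zero = r `` {\<zero>\<^bsub>V\<^esub>},
      add = (\<lambda>A B. \<Union>a\<in>A. \<Union>b\<in>B. r `` {a \<oplus>\<^bsub>V\<^esub> b}),
      smult = (\<lambda>c A. \<Union>a\<in>A. r `` {c \<odot>\<^bsub>V\<^esub> a}),
      nrm = (\<lambda>A. the_elem (nrm V ` A))\<rparr>"

definition Lp_fun_space :: "real \<Rightarrow> 'a measure \<Rightarrow> ('a \<Rightarrow> real) normed" where
  "Lp_fun_space p M =
     \<lparr>carrier = {f \<in> borel_measurable M. integrable M (\<lambda>x. \<bar>f x\<bar> powr p)},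
      mult = undefined, one = undefined,
      zero = (\<lambda>x. 0),
      add = (\<lambda>f g x. f x + g x),
      smult = (\<lambda>c f x. c * f x),
      nrm = (\<lambda>f. (\<integral>x. \<bar>f x\<bar> powr p \<partial>M) powr (1 / p))\<rparr>"

definition Lp_rel :: "real \<Rightarrow> 'a measure \<Rightarrow> ('a \<Rightarrow> real) rel" where
  "Lp_rel p M = {(f, g). f \<in> carrier (Lp_fun_space p M) \<and> g \<in> carrier (Lp_fun_space p M) \<and>
                         (AE x in M. f x = g x)}"

definition Lp :: "real \<Rightarrow> 'a measure \<Rightarrow> ('a \<Rightarrow> real) set normed" where
  "Lp p M = quotient_space (Lp_fun_space p M) (Lp_rel p M)"

text \<open>The pullback of (the class of) \<open>u\<close> along \<open>h\<close>, as a class in \<open>L\<^sup>p(M)\<close>.\<close>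

definition Lp_pullback ::
  "real \<Rightarrow> 'a measure \<Rightarrow> ('a \<Rightarrow> 'b) \<Rightarrow> ('b \<Rightarrow> real) set \<Rightarrow> ('a \<Rightarrow> real) set" where
  "Lp_pullback p M h A = (\<Union>u\<in>A. Lp_rel p M `` {u \<circ> h})"


section \<open>The space of co-Cauchy families modulo null families\<close>

definition co_Cauchy ::
  "real \<Rightarrow> 'i set \<Rightarrow> ('i \<Rightarrow> 'i \<Rightarrow> bool) \<Rightarrow> ('i \<Rightarrow> 'a measure) \<Rightarrow> ('i \<Rightarrow> 'i \<Rightarrow> 'a \<Rightarrow> 'a) \<Rightarrow>
   ('i \<Rightarrow> ('a \<Rightarrow> real) set) \<Rightarrow> bool" where
  "co_Cauchy p I leq X \<pi> f \<longleftrightarrow>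
     f \<in> (\<Pi>\<^sub>E i\<in>I. carrier (Lp p (X i))) \<and>
     (\<forall>\<epsilon>>0. \<exists>l\<in>I. \<forall>i\<in>I. \<forall>j\<in>I. leq l i \<longrightarrow> leq i j \<longrightarrow>
        \<parallel>Lp_pullback p (X j) (\<pi> i j) (f i) \<ominus>\<^bsub>Lp p (X j)\<^esub> f j\<parallel>\<^bsub>Lp p (X j)\<^esub> < \<epsilon>)"

definition co_Cauchy_space ::
  "real \<Rightarrow> 'i set \<Rightarrow> ('i \<Rightarrow> 'i \<Rightarrow> bool) \<Rightarrow> ('i \<Rightarrow> 'a measure) \<Rightarrow> ('i \<Rightarrow> 'i \<Rightarrow> 'a \<Rightarrow> 'a) \<Rightarrow>
   ('i \<Rightarrow> ('a \<Rightarrow> real) set) normed" where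
  "co_Cauchy_space p I leq X \<pi> =
     \<lparr>carrier = {f. co_Cauchy p I leq X \<pi> f},
      mult = undefined, one = undefined,
      zero = (\<lambda>i\<in>I. \<zero>\<^bsub>Lp p (X i)\<^esub>),
      add = (\<lambda>f g. \<lambda>i\<in>I. f i \<oplus>\<^bsub>Lp p (X i)\<^esub> g i),
      smult = (\<lambda>c f. \<lambda>i\<in>I. c \<odot>\<^bsub>Lp p (X i)\<^esub> f i),
      nrm = (\<lambda>f. Lim (net_filter I leq) (\<lambda>i. \<parallel>f i\<parallel>\<^bsub>Lp p (X i)\<^esub>))\<rparr>"

definition co_Cauchy_rel ::
  "real \<Rightarrow> 'i set \<Rightarrow> ('i \<Rightarrow> 'i \<Rightarrow> bool) \<Rightarrow> ('i \<Rightarrow> 'a measure) \<Rightarrow> ('i \<Rightarrow> 'i \<Rightarrow> 'a \<Rightarrow> 'a) \<Rightarrow>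
   ('i \<Rightarrow> ('a \<Rightarrow> real) set) rel" where
  "co_Cauchy_rel p I leq X \<pi> =
     {(f, g). co_Cauchy p I leq X \<pi> f \<and> co_Cauchy p I leq X \<pi> g \<and>
              ((\<lambda>i. \<parallel>f i \<ominus>\<^bsub>Lp p (X i)\<^esub> g i\<parallel>\<^bsub>Lp p (X i)\<^esub>) \<longlongrightarrow> 0) (net_filter I leq)}"

definition script_Lp ::
  "real \<Rightarrow> 'i set \<Rightarrow> ('i \<Rightarrow> 'i \<Rightarrow> bool) \<Rightarrow> ('i \<Rightarrow> 'a measure) \<Rightarrow> ('i \<Rightarrow> 'i \<Rightarrow> 'a \<Rightarrow> 'a) \<Rightarrow>
   ('i \<Rightarrow> ('a \<Rightarrow> real) set) set normed" where
  "script_Lp p I leq X \<pi> = quotient_space (co_Cauchy_space p I leq X \<pi>) (co_Cauchy_rel p I leq X \<pi>)"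

definition script_Lp_inj ::
  "real \<Rightarrow> 'i set \<Rightarrow> ('i \<Rightarrow> 'i \<Rightarrow> bool) \<Rightarrow> ('i \<Rightarrow> 'a measure) \<Rightarrow> ('i \<Rightarrow> 'i \<Rightarrow> 'a \<Rightarrow> 'a) \<Rightarrow>
   'i \<Rightarrow> ('a \<Rightarrow> real) set \<Rightarrow> ('i \<Rightarrow> ('a \<Rightarrow> real) set) set" where
  "script_Lp_inj p I leq X \<pi> i u =
     co_Cauchy_rel p I leq X \<pi> ``
       {\<lambda>j\<in>I. if leq i j then Lp_pullback p (X j) (\<pi> i j) u else \<zero>\<^bsub>Lp p (X j)\<^esub>}"

end

theory Submission
  imports Defs
begin

text \<open>
The spaces \<open>L\<^sup>p(X\<^sub>i)\<close> are Banach spaces, and the pullbacks between them are isometries because the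
\<open>\<pi>\<^sub>i\<^sub>j\<close> preserve the measures (\<open>ban_codiagram_Lp\<close>). The rest of the argument takes place in an arbitrary
directed codiagram \<open>(Z\<^sub>i, \<phi>\<^sub>i\<^sub>j)\<close> of Banach spaces, where one expects the
colimit to be the completion of the increasing union of the \<open>Z\<^sub>i\<close>. Co-Cauchy families modulo null
families are a model of this completion: since the \<open>\<phi>\<^sub>i\<^sub>j\<close> are isometries, \<open>(f\<^sub>i)\<close> is co-Cauchy exactly
when the net of the \<open>\<psi>\<^sub>i(f\<^sub>i)\<close> is Cauchy, and then this net converges to the class of \<open>(f\<^sub>i)\<close>
(\<open>extend_family_approx\<close>). Hence the images of the \<open>\<psi>\<^sub>i\<close> are dense, so that an isometry out of the space
of classes is determined by its composites with the \<open>\<psi>\<^sub>i\<close>. Conversely, for a cocone \<open>(W, \<rho>\<^sub>i)\<close> the net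
\<open>\<rho>\<^sub>i(f\<^sub>i)\<close> is Cauchy in \<open>W\<close>, and \<open>(f\<^sub>i) \<mapsto> lim \<rho>\<^sub>i(f\<^sub>i)\<close> is the required isometry
(\<open>ban_colimit_family_space\<close>).

The delicate point is that the space of classes is complete (\<open>seq_complete_family_space\<close>). A Cauchy
sequence of families can be replaced by a sequence of elements \<open>z\<^sub>n\<close> sitting at indices
\<open>a\<^sub>0 \<le> a\<^sub>1 \<le> \<dots>\<close>, but this sequence of indices is in general neither bounded nor cofinal in \<open>I\<close>. If it has an
upper bound \<open>b\<close>, the limit already exists in the Banach space \<open>Z\<^sub>b\<close>. If it has none, every \<open>j\<close> lies above
only an initial segment of the \<open>a\<^sub>n\<close>, and pushing the last \<open>z\<^sub>n\<close> of this segment to \<open>Z\<^sub>j\<close> gives a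
co-Cauchy family which is the limit.

Both \<open>L\<^sup>p\<close> and the space of classes arise from a seminormed space by dividing out the vectors
of seminorm zero. That quotient is treated once, for arbitrary seminormed spaces
(\<open>seq_complete_null_quotient\<close>, \<open>linear_isometry_from_null_quotient\<close>), and the analysis then takes place
on functions and families instead of classes. For \<open>L\<^sup>p\<close> this leaves Minkowski's inequality
(\<open>Lp_Minkowski\<close>) and completeness (\<open>Riesz_Fischer\<close>).
\<close>

section \<open>Seminormed spaces\<close>

lemma real_ring_simps [simp]:
  "carrier real_ring = UNIV" "mult real_ring = (*)" "one real_ring = 1"
  "zero real_ring = 0" "add real_ring = (+)"
  by (simp_all add: real_ring_def)

lemma cring_real_ring: "cring real_ring"
proof (rule cringI)
  show "abelian_group real_ring"
    by (rule abelian_groupI) (auto intro: exI[of _ "- x" for x :: real])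
  show "comm_monoid real_ring"
    by (rule comm_monoidI) auto
qed (auto simp: algebra_simps)

lemma a_inv_real_ring [simp]: "a_inv real_ring x = - x"
proof -
  interpret cring real_ring by (rule cring_real_ring)
  have "- x \<oplus>\<^bsub>real_ring\<^esub> x = \<zero>\<^bsub>real_ring\<^esub>" by simp
  then show ?thesis
    using minus_equality[of "- x" x] by (simp del: real_ring_simps(4,5) add: real_ring_simps(1))
qed

locale seminormed_space = Module.module real_ring V
  for V :: "'v normed" (structure) +
  assumes nrm_smult: "x \<in> carrier V \<Longrightarrow> \<parallel>a \<odot> x\<parallel> = \<bar>a\<bar> * \<parallel>x\<parallel>"
    and nrm_triangle: "x \<in> carrier V \<Longrightarrow> y \<in> carrier V \<Longrightarrow> \<parallel>x \<oplus> y\<parallel> \<le> \<parallel>x\<parallel> + \<parallel>y\<parallel>"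

text \<open>Since \<open>(- 1) \<odot> x\<close> is the additive inverse of \<open>x\<close>, a real vector space needs no separate
  inverse operation; this spares every application the computation of \<open>\<ominus> x\<close>.\<close>

lemma seminormed_spaceI:
  fixes V (structure)
  assumes "\<And>x y. x \<in> carrier V \<Longrightarrow> y \<in> carrier V \<Longrightarrow> x \<oplus> y \<in> carrier V"
    and "\<zero> \<in> carrier V"
    and smult_closed: "\<And>a x. x \<in> carrier V \<Longrightarrow> a \<odot> x \<in> carrier V"
    and "\<And>x y z. x \<in> carrier V \<Longrightarrow> y \<in> carrier V \<Longrightarrow> z \<in> carrier V \<Longrightarrow>
           (x \<oplus> y) \<oplus> z = x \<oplus> (y \<oplus> z)"
    and "\<And>x y. x \<in> carrier V \<Longrightarrow> y \<in> carrier V \<Longrightarrow> x \<oplus> y = y \<oplus> x"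
    and "\<And>x. x \<in> carrier V \<Longrightarrow> \<zero> \<oplus> x = x"
    and inverse: "\<And>x. x \<in> carrier V \<Longrightarrow> (- 1) \<odot> x \<oplus> x = \<zero>"
    and "\<And>a b x. x \<in> carrier V \<Longrightarrow> (a + b) \<odot> x = a \<odot> x \<oplus> b \<odot> x"
    and "\<And>a x y. x \<in> carrier V \<Longrightarrow> y \<in> carrier V \<Longrightarrow> a \<odot> (x \<oplus> y) = a \<odot> x \<oplus> a \<odot> y"
    and "\<And>a b x. x \<in> carrier V \<Longrightarrow> (a * b) \<odot> x = a \<odot> (b \<odot> x)"
    and "\<And>x. x \<in> carrier V \<Longrightarrow> 1 \<odot> x = x"
    and nrm: "\<And>a x. x \<in> carrier V \<Longrightarrow> \<parallel>a \<odot> x\<parallel> = \<bar>a\<bar> * \<parallel>x\<parallel>"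
      "\<And>x y. x \<in> carrier V \<Longrightarrow> y \<in> carrier V \<Longrightarrow> \<parallel>x \<oplus> y\<parallel> \<le> \<parallel>x\<parallel> + \<parallel>y\<parallel>"
  shows "seminormed_space V"
proof -
  have "abelian_group V"
  proof (rule abelian_groupI)
    show "\<exists>y\<in>carrier V. y \<oplus> x = \<zero>" if "x \<in> carrier V" for x
      using inverse[OF that] smult_closed[OF that] by blast
  qed (use assms in auto)
  then have "Module.module real_ring V"
    using assms by (intro moduleI cring_real_ring) auto
  then show ?thesis
    by (simp add: seminormed_space_def seminormed_space_axioms_def nrm)
qed

sublocale normed_space \<subseteq> seminormed_space
  by (intro seminormed_space.intro seminormed_space_axioms.intro module_axioms nrm_smult nrm_triangle)

context seminormed_space
begin

lemma smult_in_carrier [simp, intro]: "x \<in> carrier V \<Longrightarrow> a \<odot> x \<in> carrier V"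
  by (rule smult_closed) auto

lemma minus_eq_smult: "x \<in> carrier V \<Longrightarrow> y \<in> carrier V \<Longrightarrow> x \<ominus> y = x \<oplus> (- 1) \<odot> y"
  using smult_l_minus[of 1 y] smult_one[of y] by (simp add: a_minus_def)

lemma nrm_zero [simp]: "\<parallel>\<zero>\<parallel> = 0"
  using nrm_smult[of \<zero> 0] smult_l_null[of \<zero>] by simp

lemma nrm_a_inv: "x \<in> carrier V \<Longrightarrow> \<parallel>\<ominus> x\<parallel> = \<parallel>x\<parallel>"
  using smult_l_minus[of 1 x] smult_one[of x] nrm_smult[of x "- 1"] by simp

lemma nrm_nonneg: "x \<in> carrier V \<Longrightarrow> 0 \<le> \<parallel>x\<parallel>"
  using nrm_triangle[of x "\<ominus> x"] by (simp add: r_neg nrm_a_inv)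

lemma dist_self [simp]: "x \<in> carrier V \<Longrightarrow> \<parallel>x \<ominus> x\<parallel> = 0"
  by (simp add: a_minus_def r_neg)

lemma dist_nonneg: "x \<in> carrier V \<Longrightarrow> y \<in> carrier V \<Longrightarrow> 0 \<le> \<parallel>x \<ominus> y\<parallel>"
  by (simp add: nrm_nonneg)

lemma dist_commute: "x \<in> carrier V \<Longrightarrow> y \<in> carrier V \<Longrightarrow> \<parallel>x \<ominus> y\<parallel> = \<parallel>y \<ominus> x\<parallel>"
  using nrm_a_inv[of "x \<ominus> y"] by (simp add: a_minus_def minus_add a_comm)

lemma dist_triangle:
  assumes "x \<in> carrier V" "y \<in> carrier V" "z \<in> carrier V"
  shows "\<parallel>x \<ominus> z\<parallel> \<le> \<parallel>x \<ominus> y\<parallel> + \<parallel>y \<ominus> z\<parallel>"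
proof -
  have "x \<ominus> z = (x \<ominus> y) \<oplus> (y \<ominus> z)"
    using assms by (simp add: a_minus_def a_assoc r_neg1)
  then show ?thesis using assms nrm_triangle[of "x \<ominus> y" "y \<ominus> z"] by simp
qed

lemma dist_zero [simp]: "x \<in> carrier V \<Longrightarrow> \<parallel>x \<ominus> \<zero>\<parallel> = \<parallel>x\<parallel>"
  using minus_eq_smult[of x \<zero>] smult_r_null[of "- 1"] by simp

lemma nrm_diff_le: "x \<in> carrier V \<Longrightarrow> y \<in> carrier V \<Longrightarrow> \<bar>\<parallel>x\<parallel> - \<parallel>y\<parallel>\<bar> \<le> \<parallel>x \<ominus> y\<parallel>"
  using dist_triangle[of x y \<zero>] dist_triangle[of y x \<zero>] dist_commute[of x y] by simp

lemma dist_add: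
  assumes "x \<in> carrier V" "y \<in> carrier V" "x' \<in> carrier V" "y' \<in> carrier V"
  shows "\<parallel>(x \<oplus> y) \<ominus> (x' \<oplus> y')\<parallel> \<le> \<parallel>x \<ominus> x'\<parallel> + \<parallel>y \<ominus> y'\<parallel>"
proof -
  have "(x \<oplus> y) \<ominus> (x' \<oplus> y') = (x \<ominus> x') \<oplus> (y \<ominus> y')"
    using assms by (simp add: a_minus_def minus_add a_ac)
  then show ?thesis using assms nrm_triangle[of "x \<ominus> x'" "y \<ominus> y'"] by simp
qed

lemma dist_smult:
  assumes "x \<in> carrier V" "y \<in> carrier V"
  shows "\<parallel>a \<odot> x \<ominus> a \<odot> y\<parallel> = \<bar>a\<bar> * \<parallel>x \<ominus> y\<parallel>"
proof -
  have "a \<odot> x \<ominus> a \<odot> y = a \<odot> (x \<ominus> y)"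
    using assms by (simp add: minus_eq_smult smult_r_distr flip: smult_assoc1[simplified])
  then show ?thesis using assms by (simp add: nrm_smult)
qed

end

lemma linear_isometry_dist:
  assumes "seminormed_space V" "seminormed_space W" "linear_isometry V W f"
    and "x \<in> carrier V" "y \<in> carrier V"
  shows "\<parallel>f x \<ominus>\<^bsub>W\<^esub> f y\<parallel>\<^bsub>W\<^esub> = \<parallel>x \<ominus>\<^bsub>V\<^esub> y\<parallel>\<^bsub>V\<^esub>"
proof -
  interpret V: seminormed_space V by fact
  interpret W: seminormed_space W by fact
  have "f x \<in> carrier W" "f y \<in> carrier W" and "f (x \<ominus>\<^bsub>V\<^esub> y) = f x \<ominus>\<^bsub>W\<^esub> f y"
    using assms(3-) unfolding linear_isometry_def
    by (auto simp: V.minus_eq_smult W.minus_eq_smult Pi_iff)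
  then show ?thesis
    using assms(3-) unfolding linear_isometry_def by (metis V.minus_closed)
qed

lemma linear_isometry_comp:
  "linear_isometry U V f \<Longrightarrow> linear_isometry V W g \<Longrightarrow> linear_isometry U W (\<lambda>x. g (f x))"
  unfolding linear_isometry_def by (auto simp: Pi_iff)

text \<open>Completeness for seminorms, to which \<open>Metric_space\<close> does not apply: distinct vectors may have
  distance zero.\<close>

definition seq_complete :: "'v normed \<Rightarrow> bool" where
  "seq_complete V \<longleftrightarrow>
     (\<forall>\<sigma>. range \<sigma> \<subseteq> carrier V \<longrightarrow>
        (\<forall>\<epsilon>>0. \<exists>N. \<forall>m\<ge>N. \<forall>n\<ge>N. \<parallel>\<sigma> m \<ominus>\<^bsub>V\<^esub> \<sigma> n\<parallel>\<^bsub>V\<^esub> < \<epsilon>) \<longrightarrow>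
        (\<exists>x\<in>carrier V. (\<lambda>n. \<parallel>\<sigma> n \<ominus>\<^bsub>V\<^esub> x\<parallel>\<^bsub>V\<^esub>) \<longlonglongrightarrow> 0))"

lemma (in normed_space) Metric_space_nrm_dist: "Metric_space (carrier V) (nrm_dist V)"
proof
  have zero: "x \<ominus> y = \<zero> \<Longrightarrow> x = y" if "x \<in> carrier V" "y \<in> carrier V" for x y
    using that by (metis a_minus_def minus_equality minus_minus a_inv_closed)
  show "x \<in> carrier V \<Longrightarrow> y \<in> carrier V \<Longrightarrow> (nrm_dist V x y = 0) = (x = y)" for x y
    using zero[of x y] nrm_eq_0_iff[of "x \<ominus> y"] by (auto simp: nrm_dist_def)
qed (auto simp: nrm_dist_def dist_nonneg dist_commute intro: dist_triangle)

lemma (in normed_space) mcomplete_iff_seq_complete: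
  "Metric_space.mcomplete (carrier V) (nrm_dist V) \<longleftrightarrow> seq_complete V"
proof -
  interpret M: Metric_space "carrier V" "nrm_dist V" by (rule Metric_space_nrm_dist)
  have "M.MCauchy \<sigma> \<longleftrightarrow> range \<sigma> \<subseteq> carrier V \<and>
      (\<forall>\<epsilon>>0. \<exists>N. \<forall>m\<ge>N. \<forall>n\<ge>N. \<parallel>\<sigma> m \<ominus> \<sigma> n\<parallel> < \<epsilon>)" for \<sigma>
    unfolding M.MCauchy_def by (auto simp: nrm_dist_def image_subset_iff)
  moreover have "limitin M.mtopology \<sigma> x sequentially \<longleftrightarrow>
      x \<in> carrier V \<and> (\<lambda>n. \<parallel>\<sigma> n \<ominus> x\<parallel>) \<longlonglongrightarrow> 0" if "range \<sigma> \<subseteq> carrier V" for \<sigma> x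
    using that by (auto simp: M.limitin_metric_dist_null nrm_dist_def image_subset_iff)
  ultimately show ?thesis
    unfolding M.mcomplete_def seq_complete_def by (auto simp: Bex_def)
qed

lemma banach_space_iff: "banach_space V \<longleftrightarrow> normed_space V \<and> seq_complete V"
  by (auto simp: banach_space_def banach_space_axioms_def normed_space.mcomplete_iff_seq_complete)

section \<open>Dividing out the null vectors of a seminorm\<close>

definition null_rel :: "'v normed \<Rightarrow> 'v rel" where
  "null_rel V = {(x, y). x \<in> carrier V \<and> y \<in> carrier V \<and> \<parallel>x \<ominus>\<^bsub>V\<^esub> y\<parallel>\<^bsub>V\<^esub> = 0}"

abbreviation null_class :: "'v normed \<Rightarrow> 'v \<Rightarrow> 'v set" where
  "null_class V x \<equiv> null_rel V `` {x}"

abbreviation null_quotient :: "'v normed \<Rightarrow> 'v set normed" where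
  "null_quotient V \<equiv> quotient_space V (null_rel V)"

context seminormed_space
begin

lemma equiv_null_rel: "equiv (carrier V) (null_rel V)"
proof (rule equivI)
  show "trans (null_rel V)"
  proof (rule transI)
    fix x y z assume "(x, y) \<in> null_rel V" "(y, z) \<in> null_rel V"
    then show "(x, z) \<in> null_rel V"
      using dist_triangle[of x y z] dist_nonneg[of x z] by (auto simp: null_rel_def)
  qed
qed (auto simp: null_rel_def refl_on_def sym_def dist_commute)

lemma null_class_eq_iff:
  "x \<in> carrier V \<Longrightarrow> y \<in> carrier V \<Longrightarrow> null_class V x = null_class V y \<longleftrightarrow> \<parallel>x \<ominus> y\<parallel> = 0"
  using eq_equiv_class_iff[OF equiv_null_rel, of x y] by (simp add: null_rel_def)

lemma carrier_null_quotient: "carrier (null_quotient V) = null_class V ` carrier V"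
  by (auto simp: quotient_space_def quotient_def)

lemma null_class_in_carrier: "x \<in> carrier V \<Longrightarrow> null_class V x \<in> carrier (null_quotient V)"
  by (simp add: carrier_null_quotient)

lemma null_quotientE:
  assumes "A \<in> carrier (null_quotient V)"
  obtains x where "x \<in> carrier V" "A = null_class V x"
proof -
  from assms have "A \<in> null_class V ` carrier V" by (simp only: carrier_null_quotient)
  then show thesis by (rule imageE) (rule that)
qed

text \<open>The operations of the quotient are unions over all representatives. If the class of \<open>F y\<close> does
  not depend on the representative, such a union collapses to its value at one of them.\<close>

lemma UN_null_class:
  assumes "x \<in> carrier V" and "\<And>y. y \<in> carrier V \<Longrightarrow> \<parallel>x \<ominus> y\<parallel> = 0 \<Longrightarrow> F y = F x"
  shows "(\<Union>y\<in>null_class V x. F y) = F x"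
proof -
  have "x \<in> null_class V x" using assms(1) by (simp add: null_rel_def)
  moreover have "F y = F x" if "y \<in> null_class V x" for y
    using that by (intro assms(2)) (simp_all add: null_rel_def)
  ultimately show ?thesis by blast
qed

lemma null_quotient_add:
  assumes "x \<in> carrier V" "y \<in> carrier V"
  shows "null_class V x \<oplus>\<^bsub>null_quotient V\<^esub> null_class V y = null_class V (x \<oplus> y)"
proof -
  have *: "null_class V (a \<oplus> b) = null_class V (x \<oplus> y)"
    if "a \<in> carrier V" "b \<in> carrier V" "\<parallel>x \<ominus> a\<parallel> = 0" "\<parallel>y \<ominus> b\<parallel> = 0" for a b
    using that assms dist_add[of x y a b] dist_nonneg[of "x \<oplus> y" "a \<oplus> b"]
    by (simp add: null_class_eq_iff dist_commute[of "a \<oplus> b"])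
  have "(\<Union>b\<in>null_class V y. null_class V (a \<oplus> b)) = null_class V (a \<oplus> y)"
    if "a \<in> carrier V" "\<parallel>x \<ominus> a\<parallel> = 0" for a
  proof (rule UN_null_class[OF assms(2)])
    fix b assume "b \<in> carrier V" "\<parallel>y \<ominus> b\<parallel> = 0"
    then show "null_class V (a \<oplus> b) = null_class V (a \<oplus> y)"
      using *[of a b] *[of a y] assms that by simp
  qed
  then have "(\<Union>a\<in>null_class V x. \<Union>b\<in>null_class V y. null_class V (a \<oplus> b)) =
      (\<Union>a\<in>null_class V x. null_class V (a \<oplus> y))"
    by (auto simp: null_rel_def)
  also have "\<dots> = null_class V (x \<oplus> y)"
    using assms by (intro UN_null_class *) auto
  finally show ?thesis by (simp add: quotient_space_def)
qed

lemma null_quotient_smult: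
  assumes "x \<in> carrier V"
  shows "a \<odot>\<^bsub>null_quotient V\<^esub> null_class V x = null_class V (a \<odot> x)"
  using assms UN_null_class[of x "\<lambda>y. null_class V (a \<odot> y)"]
  by (simp add: quotient_space_def null_class_eq_iff dist_smult dist_commute)

lemma null_quotient_zero: "\<zero>\<^bsub>null_quotient V\<^esub> = null_class V \<zero>"
  by (simp add: quotient_space_def)

lemma null_quotient_nrm:
  assumes "x \<in> carrier V"
  shows "\<parallel>null_class V x\<parallel>\<^bsub>null_quotient V\<^esub> = \<parallel>x\<parallel>"
proof -
  have "\<parallel>y\<parallel> = \<parallel>x\<parallel>" if "y \<in> null_class V x" for y
    using that nrm_diff_le[of x y] by (simp add: null_rel_def)
  moreover have "x \<in> null_class V x" using assms by (simp add: null_rel_def)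
  ultimately have "nrm V ` null_class V x = {\<parallel>x\<parallel>}" by blast
  then show ?thesis by (simp add: quotient_space_def)
qed

lemmas null_quotient_simps =
  null_quotient_add null_quotient_smult null_quotient_zero null_quotient_nrm

lemma normed_space_null_quotient: "normed_space (null_quotient V)"
proof -
  have "seminormed_space (null_quotient V)"
    by (rule seminormed_spaceI)
      (auto simp: carrier_null_quotient null_quotient_simps a_ac r_neg nrm_smult
         nrm_triangle smult_l_distr[simplified] smult_r_distr[simplified]
         smult_assoc1[simplified] smult_one[simplified] smult_l_minus[of 1, simplified]
         intro!: imageI)
  moreover have "\<parallel>A\<parallel>\<^bsub>null_quotient V\<^esub> = 0 \<longleftrightarrow> A = \<zero>\<^bsub>null_quotient V\<^esub>"
    if "A \<in> carrier (null_quotient V)" for A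
  proof -
    from that obtain x where "x \<in> carrier V" "A = null_class V x"
      by (rule null_quotientE)
    then show ?thesis by (simp add: null_quotient_simps null_class_eq_iff)
  qed
  ultimately show ?thesis
    by (simp add: normed_space_def normed_space_axioms_def seminormed_space_def
        seminormed_space_axioms_def)
qed

lemma null_quotient_dist:
  assumes "x \<in> carrier V" "y \<in> carrier V"
  shows "\<parallel>null_class V x \<ominus>\<^bsub>null_quotient V\<^esub> null_class V y\<parallel>\<^bsub>null_quotient V\<^esub> = \<parallel>x \<ominus> y\<parallel>"
proof -
  interpret Q: normed_space "null_quotient V" by (rule normed_space_null_quotient)
  show ?thesis
    using assms
    by (simp add: Q.minus_eq_smult null_class_in_carrier null_quotient_simps minus_eq_smult)
qed

lemma seq_complete_null_quotient:
  assumes "seq_complete V"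
  shows "banach_space (null_quotient V)"
  unfolding banach_space_iff
proof
  let ?Q = "null_quotient V"
  show "seq_complete ?Q"
    unfolding seq_complete_def
  proof safe
    fix \<sigma> :: "nat \<Rightarrow> 'v set"
    assume "range \<sigma> \<subseteq> carrier ?Q"
    then have "\<sigma> n \<in> carrier ?Q" for n by auto
    then have "\<exists>x\<in>carrier V. \<sigma> n = null_class V x" for n
      by (rule null_quotientE) auto
    then obtain s where s: "\<And>n. s n \<in> carrier V" "\<And>n. \<sigma> n = null_class V (s n)" by metis
    assume "\<forall>\<epsilon>>0. \<exists>N. \<forall>m\<ge>N. \<forall>n\<ge>N. \<parallel>\<sigma> m \<ominus>\<^bsub>?Q\<^esub> \<sigma> n\<parallel>\<^bsub>?Q\<^esub> < \<epsilon>"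
    then have "\<forall>\<epsilon>>0. \<exists>N. \<forall>m\<ge>N. \<forall>n\<ge>N. \<parallel>s m \<ominus> s n\<parallel> < \<epsilon>"
      by (simp add: s null_quotient_dist)
    with assms s(1) obtain x where "x \<in> carrier V" "(\<lambda>n. \<parallel>s n \<ominus> x\<parallel>) \<longlonglongrightarrow> 0"
      unfolding seq_complete_def by blast
    then show "\<exists>A\<in>carrier ?Q. (\<lambda>n. \<parallel>\<sigma> n \<ominus>\<^bsub>?Q\<^esub> A\<parallel>\<^bsub>?Q\<^esub>) \<longlonglongrightarrow> 0"
      by (intro bexI[of _ "null_class V x"]) (simp_all add: s null_quotient_dist null_class_in_carrier)
  qed
qed (rule normed_space_null_quotient)

lemma linear_isometry_null_class: "linear_isometry V (null_quotient V) (null_class V)"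
  by (auto simp: linear_isometry_def null_quotient_simps null_class_in_carrier)

text \<open>How maps out of a quotient are recognised as isometries: it suffices to know them on
  representatives.\<close>

lemma linear_isometry_from_null_quotient:
  assumes "\<And>x. x \<in> carrier V \<Longrightarrow> \<Phi> (null_class V x) = f x" and "linear_isometry V W f"
  shows "linear_isometry (null_quotient V) W \<Phi>"
  unfolding linear_isometry_def
proof (intro conjI ballI allI funcsetI)
  have f: "f x \<in> carrier W" "f (x \<oplus> y) = f x \<oplus>\<^bsub>W\<^esub> f y" "f (a \<odot> x) = a \<odot>\<^bsub>W\<^esub> f x"
    "\<parallel>f x\<parallel>\<^bsub>W\<^esub> = \<parallel>x\<parallel>" if "x \<in> carrier V" "y \<in> carrier V" for x y a
    using assms(2) that unfolding linear_isometry_def by auto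
  fix A assume A: "A \<in> carrier (null_quotient V)"
  then obtain x where x: "x \<in> carrier V" "A = null_class V x" by (rule null_quotientE)
  show "\<Phi> A \<in> carrier W" "\<parallel>\<Phi> A\<parallel>\<^bsub>W\<^esub> = \<parallel>A\<parallel>\<^bsub>null_quotient V\<^esub>"
    "\<Phi> (a \<odot>\<^bsub>null_quotient V\<^esub> A) = a \<odot>\<^bsub>W\<^esub> \<Phi> A" for a
    using x by (simp_all add: assms(1) null_quotient_simps f)
  fix B assume "B \<in> carrier (null_quotient V)"
  then obtain y where y: "y \<in> carrier V" "B = null_class V y" by (rule null_quotientE)
  show "\<Phi> (A \<oplus>\<^bsub>null_quotient V\<^esub> B) = \<Phi> A \<oplus>\<^bsub>W\<^esub> \<Phi> B"
    using x y by (simp add: assms(1) null_quotient_simps f)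
qed

end

text \<open>An isometry maps null vectors to null vectors, so it descends to the quotients.\<close>

lemma UN_null_class_isometry:
  assumes "seminormed_space V" "seminormed_space W" "linear_isometry V W f" "x \<in> carrier V"
  shows "(\<Union>y\<in>null_class V x. null_class W (f y)) = null_class W (f x)"
proof -
  interpret V: seminormed_space V by fact
  interpret W: seminormed_space W by fact
  have "f y \<in> carrier W" if "y \<in> carrier V" for y
    using assms(3) that by (auto simp: linear_isometry_def)
  then show ?thesis
    using linear_isometry_dist[OF assms(1-3)] assms(4)
    by (intro V.UN_null_class) (auto simp: W.null_class_eq_iff V.dist_commute)
qed

section \<open>Convergence of Cauchy nets\<close>

lemma net_filter_neq_bot:
  assumes "directed_set I leq"
  shows "net_filter I leq \<noteq> bot"
proof -
  have "\<forall>i\<in>I. leq i i" "I \<noteq> {}"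
    using assms by (auto simp: directed_set_def dest: reflp_onD)
  then show ?thesis
    unfolding trivial_limit_def eventually_net_filter[OF assms] by blast
qed

lemma eventually_net_filterI:
  assumes "directed_set I leq" "l \<in> I" "\<And>j. j \<in> I \<Longrightarrow> leq l j \<Longrightarrow> P j"
  shows "eventually P (net_filter I leq)"
  using assms by (auto simp: eventually_net_filter)

lemma real_Cauchy_net_converges:
  fixes x :: "'i \<Rightarrow> real"
  assumes I: "directed_set I leq"
    and "\<And>e. 0 < e \<Longrightarrow> \<exists>l\<in>I. \<forall>j\<in>I. leq l j \<longrightarrow> \<bar>x l - x j\<bar> < e"
  shows "\<exists>c. (x \<longlongrightarrow> c) (net_filter I leq)"
proof -
  let ?F = "filtermap x (net_filter I leq)"
  have "cauchy_filter ?F"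
    unfolding cauchy_filter_metric_filtermap
  proof (intro allI impI)
    fix e :: real assume "0 < e"
    then obtain l where l: "l \<in> I" "\<forall>j\<in>I. leq l j \<longrightarrow> \<bar>x l - x j\<bar> < e / 2"
      using assms(2)[of "e / 2"] by auto
    have "dist (x i) (x j) < e" if "\<bar>x l - x i\<bar> < e / 2" "\<bar>x l - x j\<bar> < e / 2" for i j
      using that by (simp add: dist_real_def abs_if split: if_splits)
    then show "\<exists>P. eventually P (net_filter I leq) \<and>
        (\<forall>i j. P i \<and> P j \<longrightarrow> dist (x i) (x j) < e)"
      using l by (intro exI[of _ "\<lambda>j. \<bar>x l - x j\<bar> < e / 2"])
        (auto simp: eventually_net_filter[OF I])
  qed
  then have "\<exists>c. ?F \<le> nhds c"
    by (rule cauchy_filter_complete_converges[OF _ complete_UNIV])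
      (simp_all add: filtermap_bot_iff net_filter_neq_bot[OF I])
  then show ?thesis by (simp add: filterlim_def)
qed

text \<open>Completeness is a statement on sequences, yet it suffices for Cauchy nets: indices \<open>l n\<close> after
  which the net stays within \<open>1 / (n + 1)\<close> of \<open>y (l n)\<close> give a Cauchy sequence, even if they are neither
  increasing nor cofinal, because any two of them have a common upper bound. Its limit is the
  limit of the net.\<close>

lemma (in seminormed_space) Cauchy_net_converges:
  assumes "seq_complete V" and I: "directed_set I leq"
    and y: "\<And>i. i \<in> I \<Longrightarrow> y i \<in> carrier V"
    and Cauchy: "\<And>e. 0 < e \<Longrightarrow> \<exists>l\<in>I. \<forall>j\<in>I. leq l j \<longrightarrow> \<parallel>y l \<ominus> y j\<parallel> < e"
  shows "\<exists>x\<in>carrier V. ((\<lambda>i. \<parallel>y i \<ominus> x\<parallel>) \<longlongrightarrow> 0) (net_filter I leq)"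
proof -
  have "\<exists>l\<in>I. \<forall>j\<in>I. leq l j \<longrightarrow> \<parallel>y l \<ominus> y j\<parallel> < inverse (real (Suc n))" for n
    by (rule Cauchy) simp
  then obtain l where l: "\<And>n. l n \<in> I"
    "\<And>n j. j \<in> I \<Longrightarrow> leq (l n) j \<Longrightarrow> \<parallel>y (l n) \<ominus> y j\<parallel> < inverse (real (Suc n))"
    by metis
  have l_dist: "\<parallel>y (l m) \<ominus> y (l n)\<parallel> < inverse (real (Suc m)) + inverse (real (Suc n))" for m n
  proof -
    obtain k where k: "k \<in> I" "leq (l m) k" "leq (l n) k"
      using I l(1) unfolding directed_set_def by blast
    then show ?thesis
      using l(2)[of k m] l(2)[of k n] dist_triangle[of "y (l m)" "y k" "y (l n)"]
        dist_commute[of "y k" "y (l n)"] y l(1) by fastforce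
  qed
  have "\<exists>N. \<forall>m\<ge>N. \<forall>n\<ge>N. \<parallel>y (l m) \<ominus> y (l n)\<parallel> < e" if "0 < e" for e
  proof -
    obtain N where N: "inverse (real (Suc N)) < e / 2"
      using reals_Archimedean[of "e / 2"] \<open>0 < e\<close> by auto
    have "\<parallel>y (l m) \<ominus> y (l n)\<parallel> < e" if "N \<le> m" "N \<le> n" for m n
    proof -
      have "inverse (real (Suc m)) \<le> inverse (real (Suc N))"
        "inverse (real (Suc n)) \<le> inverse (real (Suc N))"
        using that by (auto intro!: le_imp_inverse_le)
      then show ?thesis using l_dist[of m n] N by linarith
    qed
    then show ?thesis by blast
  qed
  then obtain x where x: "x \<in> carrier V" "(\<lambda>n. \<parallel>y (l n) \<ominus> x\<parallel>) \<longlonglongrightarrow> 0"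
    using assms(1)[unfolded seq_complete_def, rule_format, of "\<lambda>n. y (l n)"] y l(1) by blast
  have "((\<lambda>i. \<parallel>y i \<ominus> x\<parallel>) \<longlongrightarrow> 0) (net_filter I leq)"
  proof (rule tendstoI)
    fix e :: real assume "0 < e"
    then have "\<forall>\<^sub>F n in sequentially. \<parallel>y (l n) \<ominus> x\<parallel> < e / 2"
      using order_tendstoD(2)[OF x(2), of "e / 2"] by simp
    moreover have "\<forall>\<^sub>F n in sequentially. inverse (real (Suc n)) < e / 2"
      using order_tendstoD(2)[OF LIMSEQ_inverse_real_of_nat, of "e / 2"] \<open>0 < e\<close> by simp
    ultimately obtain n where n: "\<parallel>y (l n) \<ominus> x\<parallel> < e / 2" "inverse (real (Suc n)) < e / 2"
      using eventually_happens'[OF sequentially_bot eventually_conj] by blast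
    show "\<forall>\<^sub>F i in net_filter I leq. dist \<parallel>y i \<ominus> x\<parallel> 0 < e"
    proof (rule eventually_net_filterI[OF I l(1)])
      fix j assume j: "j \<in> I" "leq (l n) j"
      then show "dist \<parallel>y j \<ominus> x\<parallel> 0 < e"
        using l(2)[OF j] n dist_triangle[of "y j" "y (l n)" x] dist_commute[of "y j" "y (l n)"]
          dist_nonneg[of "y j" x] x(1) y l(1) by (simp add: dist_real_def)
    qed
  qed
  with x(1) show ?thesis by blast
qed

lemma (in normed_space) net_limit_unique:
  assumes "F \<noteq> bot" "x \<in> carrier V" "x' \<in> carrier V"
    and y: "\<forall>\<^sub>F i in F. y i \<in> carrier V"
    and "((\<lambda>i. \<parallel>y i \<ominus> x\<parallel>) \<longlongrightarrow> 0) F" "((\<lambda>i. \<parallel>y i \<ominus> x'\<parallel>) \<longlongrightarrow> 0) F"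
  shows "x = x'"
proof -
  have "((\<lambda>i. \<parallel>y i \<ominus> x\<parallel> + \<parallel>y i \<ominus> x'\<parallel>) \<longlongrightarrow> 0) F"
    using tendsto_add[OF assms(5,6)] by simp
  moreover have "\<forall>\<^sub>F i in F. \<parallel>x \<ominus> x'\<parallel> \<le> \<parallel>y i \<ominus> x\<parallel> + \<parallel>y i \<ominus> x'\<parallel>"
    using y by eventually_elim
      (use assms(2,3) dist_triangle[of x _ x'] dist_commute[of x] in fastforce)
  ultimately have "\<parallel>x \<ominus> x'\<parallel> \<le> 0"
    by (intro tendsto_lowerbound[OF _ _ assms(1)])
  then have "nrm_dist V x x' = 0"
    using assms(2,3) dist_nonneg[of x x'] by (simp add: nrm_dist_def)
  then show ?thesis
    using Metric_space.zero[OF Metric_space_nrm_dist assms(2,3)] by simp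
qed

section \<open>Co-Cauchy families as the directed colimit in the category of Banach spaces\<close>

locale ban_directed_codiagram =
  fixes I :: "'i set" and leq :: "'i \<Rightarrow> 'i \<Rightarrow> bool"
    and Z :: "'i \<Rightarrow> 'z normed" and \<phi> :: "'i \<Rightarrow> 'i \<Rightarrow> 'z \<Rightarrow> 'z"
  assumes directed: "directed_set I leq"
    and codiagram: "ban_codiagram I leq Z \<phi>"
begin

abbreviation \<delta> :: "'i \<Rightarrow> 'z \<Rightarrow> 'z \<Rightarrow> real" where
  "\<delta> i x y \<equiv> \<parallel>x \<ominus>\<^bsub>Z i\<^esub> y\<parallel>\<^bsub>Z i\<^esub>"

abbreviation net :: "'i filter" where
  "net \<equiv> net_filter I leq"

lemma leq_refl: "i \<in> I \<Longrightarrow> leq i i"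
  using directed by (auto simp: directed_set_def dest: reflp_onD)

lemma leq_trans: "i \<in> I \<Longrightarrow> j \<in> I \<Longrightarrow> k \<in> I \<Longrightarrow> leq i j \<Longrightarrow> leq j k \<Longrightarrow> leq i k"
  using directed by (auto simp: directed_set_def dest: transp_onD)

lemma upper_bound:
  assumes "i \<in> I" "j \<in> I"
  obtains k where "k \<in> I" "leq i k" "leq j k"
  using directed assms unfolding directed_set_def by blast

lemma Z_banach: "i \<in> I \<Longrightarrow> banach_space (Z i)"
  using codiagram unfolding ban_codiagram_def by blast

lemma Z_seq_complete: "i \<in> I \<Longrightarrow> seq_complete (Z i)"
  using Z_banach by (simp add: banach_space_iff)

lemma Z_seminormed: "i \<in> I \<Longrightarrow> seminormed_space (Z i)"
  using Z_banach by (simp add: banach_space_iff normed_space.axioms normed_space_def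
      seminormed_space_def normed_space_axioms_def seminormed_space_axioms_def)

lemma \<phi>_isometry: "i \<in> I \<Longrightarrow> j \<in> I \<Longrightarrow> leq i j \<Longrightarrow> linear_isometry (Z i) (Z j) (\<phi> i j)"
  using codiagram unfolding ban_codiagram_def by blast

lemma \<phi>_closed: "i \<in> I \<Longrightarrow> j \<in> I \<Longrightarrow> leq i j \<Longrightarrow> x \<in> carrier (Z i) \<Longrightarrow> \<phi> i j x \<in> carrier (Z j)"
  using \<phi>_isometry unfolding linear_isometry_def by blast

lemma \<phi>_linear:
  assumes "i \<in> I" "j \<in> I" "leq i j" "x \<in> carrier (Z i)"
  shows "y \<in> carrier (Z i) \<Longrightarrow> \<phi> i j (x \<oplus>\<^bsub>Z i\<^esub> y) = \<phi> i j x \<oplus>\<^bsub>Z j\<^esub> \<phi> i j y"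
    and "\<phi> i j (a \<odot>\<^bsub>Z i\<^esub> x) = a \<odot>\<^bsub>Z j\<^esub> \<phi> i j x"
    and "\<parallel>\<phi> i j x\<parallel>\<^bsub>Z j\<^esub> = \<parallel>x\<parallel>\<^bsub>Z i\<^esub>"
  using \<phi>_isometry[OF assms(1-3)] assms(4) unfolding linear_isometry_def by blast+

lemma \<phi>_comp:
  "i \<in> I \<Longrightarrow> j \<in> I \<Longrightarrow> k \<in> I \<Longrightarrow> leq i j \<Longrightarrow> leq j k \<Longrightarrow> x \<in> carrier (Z i) \<Longrightarrow>
    \<phi> i k x = \<phi> j k (\<phi> i j x)"
  using codiagram unfolding ban_codiagram_def by blast

lemma \<phi>_dist:
  "i \<in> I \<Longrightarrow> j \<in> I \<Longrightarrow> leq i j \<Longrightarrow> x \<in> carrier (Z i) \<Longrightarrow> y \<in> carrier (Z i) \<Longrightarrow>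
    \<delta> j (\<phi> i j x) (\<phi> i j y) = \<delta> i x y"
  by (rule linear_isometry_dist[OF Z_seminormed Z_seminormed \<phi>_isometry])

lemmas \<delta>_commute = seminormed_space.dist_commute[OF Z_seminormed]
  and \<delta>_triangle = seminormed_space.dist_triangle[OF Z_seminormed]
  and \<delta>_self = seminormed_space.dist_self[OF Z_seminormed]

definition co_Cauchy_family :: "('i \<Rightarrow> 'z) \<Rightarrow> bool" where
  "co_Cauchy_family f \<longleftrightarrow>
     f \<in> (\<Pi>\<^sub>E i\<in>I. carrier (Z i)) \<and>
     (\<forall>\<epsilon>>0. \<exists>l\<in>I. \<forall>i\<in>I. \<forall>j\<in>I. leq l i \<longrightarrow> leq i j \<longrightarrow> \<delta> j (\<phi> i j (f i)) (f j) < \<epsilon>)"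

definition family_space :: "('i \<Rightarrow> 'z) normed" where
  "family_space =
     \<lparr>carrier = {f. co_Cauchy_family f},
      mult = undefined, one = undefined,
      zero = (\<lambda>i\<in>I. \<zero>\<^bsub>Z i\<^esub>),
      add = (\<lambda>f g. \<lambda>i\<in>I. f i \<oplus>\<^bsub>Z i\<^esub> g i),
      smult = (\<lambda>c f. \<lambda>i\<in>I. c \<odot>\<^bsub>Z i\<^esub> f i),
      nrm = (\<lambda>f. Lim net (\<lambda>i. \<parallel>f i\<parallel>\<^bsub>Z i\<^esub>))\<rparr>"

text \<open>The representative of \<open>\<psi> i z\<close>; modulo null families only its values above \<open>i\<close> matter, and
  zero elsewhere keeps the map linear in \<open>z\<close>.\<close>

definition extend_family :: "'i \<Rightarrow> 'z \<Rightarrow> 'i \<Rightarrow> 'z" where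
  "extend_family i z = (\<lambda>j\<in>I. if leq i j then \<phi> i j z else \<zero>\<^bsub>Z j\<^esub>)"

lemma family_space_simps [simp]:
  "f \<in> carrier family_space \<longleftrightarrow> co_Cauchy_family f"
  "\<zero>\<^bsub>family_space\<^esub> = (\<lambda>i\<in>I. \<zero>\<^bsub>Z i\<^esub>)"
  "f \<oplus>\<^bsub>family_space\<^esub> g = (\<lambda>i\<in>I. f i \<oplus>\<^bsub>Z i\<^esub> g i)"
  "c \<odot>\<^bsub>family_space\<^esub> f = (\<lambda>i\<in>I. c \<odot>\<^bsub>Z i\<^esub> f i)"
  by (simp_all add: family_space_def)

lemma co_Cauchy_family_mem: "co_Cauchy_family f \<Longrightarrow> i \<in> I \<Longrightarrow> f i \<in> carrier (Z i)"
  by (auto simp: co_Cauchy_family_def)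

lemma co_Cauchy_familyE:
  assumes "co_Cauchy_family f" "0 < e"
  obtains l where "l \<in> I"
    "\<And>i j. i \<in> I \<Longrightarrow> j \<in> I \<Longrightarrow> leq l i \<Longrightarrow> leq i j \<Longrightarrow> \<delta> j (\<phi> i j (f i)) (f j) < e"
proof -
  from assms have "\<exists>l\<in>I. \<forall>i\<in>I. \<forall>j\<in>I. leq l i \<longrightarrow> leq i j \<longrightarrow> \<delta> j (\<phi> i j (f i)) (f j) < e"
    unfolding co_Cauchy_family_def by simp
  then show thesis using that by blast
qed

lemma co_Cauchy_family_comparison:
  assumes f: "co_Cauchy_family f" and h: "h \<in> (\<Pi>\<^sub>E i\<in>I. carrier (Z i))"
    and bound: "\<And>i j. i \<in> I \<Longrightarrow> j \<in> I \<Longrightarrow> leq i j \<Longrightarrow>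
      \<delta> j (\<phi> i j (h i)) (h j) \<le> C * \<delta> j (\<phi> i j (f i)) (f j)"
    and "0 \<le> C"
  shows "co_Cauchy_family h"
  unfolding co_Cauchy_family_def
proof (intro conjI h allI impI)
  fix e :: real assume "0 < e"
  then have "0 < e / (C + 1)" using \<open>0 \<le> C\<close> by simp
  then obtain l where l: "l \<in> I"
    "\<And>i j. i \<in> I \<Longrightarrow> j \<in> I \<Longrightarrow> leq l i \<Longrightarrow> leq i j \<Longrightarrow> \<delta> j (\<phi> i j (f i)) (f j) < e / (C + 1)"
    using co_Cauchy_familyE[OF f] by metis
  have "\<delta> j (\<phi> i j (h i)) (h j) < e" if ij: "i \<in> I" "j \<in> I" "leq l i" "leq i j" for i j
  proof -
    have "\<delta> j (\<phi> i j (h i)) (h j) \<le> C * \<delta> j (\<phi> i j (f i)) (f j)"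
      using ij by (intro bound)
    also have "\<dots> \<le> C * (e / (C + 1))"
      using l(2)[OF ij] \<open>0 \<le> C\<close> by (intro mult_left_mono) auto
    also have "\<dots> < e" using \<open>0 \<le> C\<close> \<open>0 < e\<close> by (simp add: field_simps)
    finally show ?thesis .
  qed
  then show "\<exists>l\<in>I. \<forall>i\<in>I. \<forall>j\<in>I. leq l i \<longrightarrow> leq i j \<longrightarrow> \<delta> j (\<phi> i j (h i)) (h j) < e"
    using l(1) by blast
qed

lemma co_Cauchy_family_smult:
  assumes f: "co_Cauchy_family f"
  shows "co_Cauchy_family (\<lambda>i\<in>I. c \<odot>\<^bsub>Z i\<^esub> f i)"
proof (rule co_Cauchy_family_comparison[OF f])
  fix i j assume ij: "i \<in> I" "j \<in> I" "leq i j"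
  interpret Zj: seminormed_space "Z j" by (rule Z_seminormed[OF ij(2)])
  show "\<delta> j (\<phi> i j ((\<lambda>i\<in>I. c \<odot>\<^bsub>Z i\<^esub> f i) i)) ((\<lambda>i\<in>I. c \<odot>\<^bsub>Z i\<^esub> f i) j) \<le>
      \<bar>c\<bar> * \<delta> j (\<phi> i j (f i)) (f j)"
    using ij co_Cauchy_family_mem[OF f] by (simp add: \<phi>_linear \<phi>_closed Zj.dist_smult)
qed (auto intro!: seminormed_space.smult_in_carrier[OF Z_seminormed] co_Cauchy_family_mem[OF f])

lemma co_Cauchy_family_add:
  assumes f: "co_Cauchy_family f" and g: "co_Cauchy_family g"
  shows "co_Cauchy_family (\<lambda>i\<in>I. f i \<oplus>\<^bsub>Z i\<^esub> g i)"
  unfolding co_Cauchy_family_def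
proof (intro conjI allI impI)
  show "(\<lambda>i\<in>I. f i \<oplus>\<^bsub>Z i\<^esub> g i) \<in> (\<Pi>\<^sub>E i\<in>I. carrier (Z i))"
  proof (rule restrict_PiE_iff[THEN iffD2], rule)
    fix i assume i: "i \<in> I"
    interpret Zi: seminormed_space "Z i" by (rule Z_seminormed[OF i])
    show "f i \<oplus>\<^bsub>Z i\<^esub> g i \<in> carrier (Z i)"
      using co_Cauchy_family_mem[OF f i] co_Cauchy_family_mem[OF g i] by simp
  qed
  fix e :: real assume "0 < e"
  then have "0 < e / 2" by simp
  obtain l where l: "l \<in> I"
    "\<And>i j. i \<in> I \<Longrightarrow> j \<in> I \<Longrightarrow> leq l i \<Longrightarrow> leq i j \<Longrightarrow> \<delta> j (\<phi> i j (f i)) (f j) < e / 2"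
    using co_Cauchy_familyE[OF f \<open>0 < e / 2\<close>] by metis
  obtain m where m: "m \<in> I"
    "\<And>i j. i \<in> I \<Longrightarrow> j \<in> I \<Longrightarrow> leq m i \<Longrightarrow> leq i j \<Longrightarrow> \<delta> j (\<phi> i j (g i)) (g j) < e / 2"
    using co_Cauchy_familyE[OF g \<open>0 < e / 2\<close>] by metis
  obtain k where k: "k \<in> I" "leq l k" "leq m k" by (rule upper_bound[OF l(1) m(1)])
  have "\<delta> j (\<phi> i j (f i \<oplus>\<^bsub>Z i\<^esub> g i)) (f j \<oplus>\<^bsub>Z j\<^esub> g j) < e"
    if ij: "i \<in> I" "j \<in> I" "leq k i" "leq i j" for i j
  proof -
    interpret Zj: seminormed_space "Z j" by (rule Z_seminormed[OF ij(2)])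
    have "leq l i" "leq m i" using leq_trans k l(1) m(1) ij by metis+
    then show ?thesis
      using Zj.dist_add[of "\<phi> i j (f i)" "\<phi> i j (g i)" "f j" "g j"] l(2)[of i j] m(2)[of i j]
        ij co_Cauchy_family_mem[OF f] co_Cauchy_family_mem[OF g]
      by (simp add: \<phi>_linear \<phi>_closed)
  qed
  then show "\<exists>l\<in>I. \<forall>i\<in>I. \<forall>j\<in>I. leq l i \<longrightarrow> leq i j \<longrightarrow>
      \<delta> j (\<phi> i j ((\<lambda>i\<in>I. f i \<oplus>\<^bsub>Z i\<^esub> g i) i)) ((\<lambda>i\<in>I. f i \<oplus>\<^bsub>Z i\<^esub> g i) j) < e"
    using k(1) by auto
qed

lemma co_Cauchy_family_extend:
  assumes i: "i \<in> I" and z: "z \<in> carrier (Z i)"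
  shows "co_Cauchy_family (extend_family i z)"
  unfolding co_Cauchy_family_def
proof (intro conjI allI impI)
  have "\<zero>\<^bsub>Z j\<^esub> \<in> carrier (Z j)" if "j \<in> I" for j
  proof -
    interpret Zj: seminormed_space "Z j" by (rule Z_seminormed[OF that])
    show ?thesis by simp
  qed
  then show "extend_family i z \<in> (\<Pi>\<^sub>E i\<in>I. carrier (Z i))"
    using i z by (auto simp: extend_family_def \<phi>_closed)
  fix e :: real assume "0 < e"
  have "\<delta> k (\<phi> j k (extend_family i z j)) (extend_family i z k) < e"
    if jk: "j \<in> I" "k \<in> I" "leq i j" "leq j k" for j k
    using \<open>0 < e\<close> i z jk leq_trans[OF i jk]
    by (simp add: extend_family_def \<phi>_comp[of i j k] \<delta>_self \<phi>_closed)
  then show "\<exists>l\<in>I. \<forall>j\<in>I. \<forall>k\<in>I. leq l j \<longrightarrow> leq j k \<longrightarrow>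
      \<delta> k (\<phi> j k (extend_family i z j)) (extend_family i z k) < e"
    using i by blast
qed

lemma co_Cauchy_family_zero: "co_Cauchy_family (\<lambda>i\<in>I. \<zero>\<^bsub>Z i\<^esub>)"
proof -
  \<comment> \<open>The zero family is \<open>0\<close> times any co-Cauchy family, for instance an extended zero vector.\<close>
  obtain i where i: "i \<in> I" using directed by (auto simp: directed_set_def)
  interpret Zi: seminormed_space "Z i" by (rule Z_seminormed[OF i])
  have "(0::real) \<odot>\<^bsub>Z j\<^esub> extend_family i \<zero>\<^bsub>Z i\<^esub> j = \<zero>\<^bsub>Z j\<^esub>" if "j \<in> I" for j
  proof -
    interpret Zj: seminormed_space "Z j" by (rule Z_seminormed[OF that])
    show ?thesis
      using Zj.smult_l_null co_Cauchy_family_mem[OF co_Cauchy_family_extend[OF i] that] by simp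
  qed
  then have "(\<lambda>j\<in>I. 0 \<odot>\<^bsub>Z j\<^esub> extend_family i \<zero>\<^bsub>Z i\<^esub> j) = (\<lambda>j\<in>I. \<zero>\<^bsub>Z j\<^esub>)" by auto
  then show ?thesis
    using co_Cauchy_family_smult[OF co_Cauchy_family_extend[OF i], of "\<zero>\<^bsub>Z i\<^esub>" 0] by simp
qed

lemma family_nrm_tendsto:
  assumes f: "co_Cauchy_family f"
  shows "((\<lambda>i. \<parallel>f i\<parallel>\<^bsub>Z i\<^esub>) \<longlongrightarrow> \<parallel>f\<parallel>\<^bsub>family_space\<^esub>) net"
proof -
  have "\<exists>l\<in>I. \<forall>j\<in>I. leq l j \<longrightarrow> \<bar>\<parallel>f l\<parallel>\<^bsub>Z l\<^esub> - \<parallel>f j\<parallel>\<^bsub>Z j\<^esub>\<bar> < e" if "0 < e" for e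
  proof -
    obtain l where l: "l \<in> I"
      "\<And>i j. i \<in> I \<Longrightarrow> j \<in> I \<Longrightarrow> leq l i \<Longrightarrow> leq i j \<Longrightarrow> \<delta> j (\<phi> i j (f i)) (f j) < e"
      using co_Cauchy_familyE[OF f \<open>0 < e\<close>] by metis
    have "\<bar>\<parallel>f l\<parallel>\<^bsub>Z l\<^esub> - \<parallel>f j\<parallel>\<^bsub>Z j\<^esub>\<bar> < e" if j: "j \<in> I" "leq l j" for j
      using seminormed_space.nrm_diff_le[OF Z_seminormed[OF j(1)], of "\<phi> l j (f l)" "f j"]
        l(2)[OF l(1) j(1) leq_refl j(2)] l(1) j co_Cauchy_family_mem[OF f]
      by (simp add: \<phi>_linear \<phi>_closed)
    with l(1) show ?thesis by blast
  qed
  then obtain c where "((\<lambda>i. \<parallel>f i\<parallel>\<^bsub>Z i\<^esub>) \<longlongrightarrow> c) net"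
    using real_Cauchy_net_converges[OF directed, of "\<lambda>i. \<parallel>f i\<parallel>\<^bsub>Z i\<^esub>"] by blast
  moreover from this have "Lim net (\<lambda>i. \<parallel>f i\<parallel>\<^bsub>Z i\<^esub>) = c"
    by (rule tendsto_Lim[OF net_filter_neq_bot[OF directed]])
  ultimately show ?thesis by (simp add: family_space_def)
qed

lemma eventually_net_mem: "\<forall>\<^sub>F i in net. i \<in> I"
  using directed by (auto simp: eventually_net_filter directed_set_def)

lemma seminormed_space_family_space: "seminormed_space family_space"
proof (rule seminormed_spaceI)
  fix f :: "'i \<Rightarrow> 'z" and c :: real
  assume "f \<in> carrier family_space"
  then have f: "co_Cauchy_family f" by simp
  have fi: "f i \<in> carrier (Z i)" if "i \<in> I" for i
    by (rule co_Cauchy_family_mem[OF f that])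
  show "c \<odot>\<^bsub>family_space\<^esub> f \<in> carrier family_space"
    using f by (simp add: co_Cauchy_family_smult)
  have "((\<lambda>i. \<parallel>(c \<odot>\<^bsub>family_space\<^esub> f) i\<parallel>\<^bsub>Z i\<^esub>) \<longlongrightarrow> \<bar>c\<bar> * \<parallel>f\<parallel>\<^bsub>family_space\<^esub>) net"
  proof (rule Lim_transform_eventually[OF tendsto_mult_left[OF family_nrm_tendsto[OF f]]])
    show "\<forall>\<^sub>F i in net. \<bar>c\<bar> * \<parallel>f i\<parallel>\<^bsub>Z i\<^esub> = \<parallel>(c \<odot>\<^bsub>family_space\<^esub> f) i\<parallel>\<^bsub>Z i\<^esub>"
      using eventually_net_mem
      by eventually_elim (simp add: fi seminormed_space.nrm_smult[OF Z_seminormed])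
  qed
  then show "\<parallel>c \<odot>\<^bsub>family_space\<^esub> f\<parallel>\<^bsub>family_space\<^esub> = \<bar>c\<bar> * \<parallel>f\<parallel>\<^bsub>family_space\<^esub>"
    using tendsto_unique[OF net_filter_neq_bot[OF directed]]
      family_nrm_tendsto[of "c \<odot>\<^bsub>family_space\<^esub> f"] co_Cauchy_family_smult[OF f]
    by fastforce
  have outside: "f i = undefined" if "i \<notin> I" for i
    using f that by (auto simp: co_Cauchy_family_def)
  have pointwise: "\<zero>\<^bsub>Z i\<^esub> \<oplus>\<^bsub>Z i\<^esub> f i = f i" "(- 1) \<odot>\<^bsub>Z i\<^esub> f i \<oplus>\<^bsub>Z i\<^esub> f i = \<zero>\<^bsub>Z i\<^esub>"
    "(a + b) \<odot>\<^bsub>Z i\<^esub> f i = a \<odot>\<^bsub>Z i\<^esub> f i \<oplus>\<^bsub>Z i\<^esub> b \<odot>\<^bsub>Z i\<^esub> f i"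
    "(a * b) \<odot>\<^bsub>Z i\<^esub> f i = a \<odot>\<^bsub>Z i\<^esub> (b \<odot>\<^bsub>Z i\<^esub> f i)" "1 \<odot>\<^bsub>Z i\<^esub> f i = f i"
    if "i \<in> I" for i a b
  proof -
    interpret Zi: seminormed_space "Z i" by (rule Z_seminormed[OF that])
    show "\<zero>\<^bsub>Z i\<^esub> \<oplus>\<^bsub>Z i\<^esub> f i = f i" "(- 1) \<odot>\<^bsub>Z i\<^esub> f i \<oplus>\<^bsub>Z i\<^esub> f i = \<zero>\<^bsub>Z i\<^esub>"
      "(a + b) \<odot>\<^bsub>Z i\<^esub> f i = a \<odot>\<^bsub>Z i\<^esub> f i \<oplus>\<^bsub>Z i\<^esub> b \<odot>\<^bsub>Z i\<^esub> f i"
      "(a * b) \<odot>\<^bsub>Z i\<^esub> f i = a \<odot>\<^bsub>Z i\<^esub> (b \<odot>\<^bsub>Z i\<^esub> f i)" "1 \<odot>\<^bsub>Z i\<^esub> f i = f i"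
      using fi[OF that] Zi.smult_l_distr[of a b "f i"] Zi.smult_assoc1[of a b "f i"]
        Zi.smult_one[of "f i"] Zi.smult_l_minus[of 1 "f i"] Zi.l_neg[of "f i"] by simp_all
  qed
  show "\<zero>\<^bsub>family_space\<^esub> \<oplus>\<^bsub>family_space\<^esub> f = f"
    "(- 1) \<odot>\<^bsub>family_space\<^esub> f \<oplus>\<^bsub>family_space\<^esub> f = \<zero>\<^bsub>family_space\<^esub>"
    "(a + b) \<odot>\<^bsub>family_space\<^esub> f = a \<odot>\<^bsub>family_space\<^esub> f \<oplus>\<^bsub>family_space\<^esub> b \<odot>\<^bsub>family_space\<^esub> f"
    "(a * b) \<odot>\<^bsub>family_space\<^esub> f = a \<odot>\<^bsub>family_space\<^esub> (b \<odot>\<^bsub>family_space\<^esub> f)"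
    "1 \<odot>\<^bsub>family_space\<^esub> f = f" for a b
    by (simp_all add: fun_eq_iff pointwise outside)
  fix g :: "'i \<Rightarrow> 'z"
  assume "g \<in> carrier family_space"
  then have g: "co_Cauchy_family g" by simp
  have gi: "g i \<in> carrier (Z i)" if "i \<in> I" for i
    by (rule co_Cauchy_family_mem[OF g that])
  have fg: "co_Cauchy_family (f \<oplus>\<^bsub>family_space\<^esub> g)"
    using co_Cauchy_family_add[OF f g] by (simp only: family_space_simps)
  then show "f \<oplus>\<^bsub>family_space\<^esub> g \<in> carrier family_space"
    by (simp only: family_space_simps(1))
  have "f i \<oplus>\<^bsub>Z i\<^esub> g i = g i \<oplus>\<^bsub>Z i\<^esub> f i"
    "c \<odot>\<^bsub>Z i\<^esub> (f i \<oplus>\<^bsub>Z i\<^esub> g i) = c \<odot>\<^bsub>Z i\<^esub> f i \<oplus>\<^bsub>Z i\<^esub> c \<odot>\<^bsub>Z i\<^esub> g i" if "i \<in> I" for i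
  proof -
    interpret Zi: seminormed_space "Z i" by (rule Z_seminormed[OF that])
    show "f i \<oplus>\<^bsub>Z i\<^esub> g i = g i \<oplus>\<^bsub>Z i\<^esub> f i"
      using fi[OF that] gi[OF that] by (rule Zi.a_comm)
    show "c \<odot>\<^bsub>Z i\<^esub> (f i \<oplus>\<^bsub>Z i\<^esub> g i) = c \<odot>\<^bsub>Z i\<^esub> f i \<oplus>\<^bsub>Z i\<^esub> c \<odot>\<^bsub>Z i\<^esub> g i"
      using fi[OF that] gi[OF that] by (intro Zi.smult_r_distr) simp_all
  qed
  then show "f \<oplus>\<^bsub>family_space\<^esub> g = g \<oplus>\<^bsub>family_space\<^esub> f"
    "c \<odot>\<^bsub>family_space\<^esub> (f \<oplus>\<^bsub>family_space\<^esub> g) =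
      c \<odot>\<^bsub>family_space\<^esub> f \<oplus>\<^bsub>family_space\<^esub> c \<odot>\<^bsub>family_space\<^esub> g"
    by (auto simp: fun_eq_iff)
  show "\<parallel>f \<oplus>\<^bsub>family_space\<^esub> g\<parallel>\<^bsub>family_space\<^esub> \<le>
      \<parallel>f\<parallel>\<^bsub>family_space\<^esub> + \<parallel>g\<parallel>\<^bsub>family_space\<^esub>"
  proof (rule tendsto_le[OF net_filter_neq_bot[OF directed]])
    show "((\<lambda>i. \<parallel>f i\<parallel>\<^bsub>Z i\<^esub> + \<parallel>g i\<parallel>\<^bsub>Z i\<^esub>) \<longlongrightarrow>
        \<parallel>f\<parallel>\<^bsub>family_space\<^esub> + \<parallel>g\<parallel>\<^bsub>family_space\<^esub>) net"
      by (intro tendsto_add family_nrm_tendsto f g)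
    show "((\<lambda>i. \<parallel>(f \<oplus>\<^bsub>family_space\<^esub> g) i\<parallel>\<^bsub>Z i\<^esub>) \<longlongrightarrow>
        \<parallel>f \<oplus>\<^bsub>family_space\<^esub> g\<parallel>\<^bsub>family_space\<^esub>) net"
      by (rule family_nrm_tendsto[OF fg])
    show "\<forall>\<^sub>F i in net. \<parallel>(f \<oplus>\<^bsub>family_space\<^esub> g) i\<parallel>\<^bsub>Z i\<^esub> \<le> \<parallel>f i\<parallel>\<^bsub>Z i\<^esub> + \<parallel>g i\<parallel>\<^bsub>Z i\<^esub>"
      using eventually_net_mem
      by eventually_elim (simp add: fi gi seminormed_space.nrm_triangle[OF Z_seminormed])
  qed
  fix h :: "'i \<Rightarrow> 'z"
  assume "h \<in> carrier family_space"
  then have h: "co_Cauchy_family h" by simp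
  have "(f i \<oplus>\<^bsub>Z i\<^esub> g i) \<oplus>\<^bsub>Z i\<^esub> h i = f i \<oplus>\<^bsub>Z i\<^esub> (g i \<oplus>\<^bsub>Z i\<^esub> h i)" if "i \<in> I" for i
  proof -
    interpret Zi: seminormed_space "Z i" by (rule Z_seminormed[OF that])
    show ?thesis
      using fi[OF that] gi[OF that] co_Cauchy_family_mem[OF h that] by (rule Zi.a_assoc)
  qed
  then show "(f \<oplus>\<^bsub>family_space\<^esub> g) \<oplus>\<^bsub>family_space\<^esub> h = f \<oplus>\<^bsub>family_space\<^esub> (g \<oplus>\<^bsub>family_space\<^esub> h)"
    by (simp add: fun_eq_iff)
qed (simp add: co_Cauchy_family_zero)

interpretation S: seminormed_space family_space
  by (rule seminormed_space_family_space)

lemma family_dist_tendsto: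
  assumes f: "co_Cauchy_family f" and g: "co_Cauchy_family g"
  shows "((\<lambda>i. \<delta> i (f i) (g i)) \<longlongrightarrow> \<parallel>f \<ominus>\<^bsub>family_space\<^esub> g\<parallel>\<^bsub>family_space\<^esub>) net"
proof (rule Lim_transform_eventually)
  have "f \<ominus>\<^bsub>family_space\<^esub> g \<in> carrier family_space"
    using f g by (intro S.minus_closed) simp_all
  then show "((\<lambda>i. \<parallel>(f \<ominus>\<^bsub>family_space\<^esub> g) i\<parallel>\<^bsub>Z i\<^esub>) \<longlongrightarrow>
      \<parallel>f \<ominus>\<^bsub>family_space\<^esub> g\<parallel>\<^bsub>family_space\<^esub>) net"
    by (intro family_nrm_tendsto) simp
  show "\<forall>\<^sub>F i in net. \<parallel>(f \<ominus>\<^bsub>family_space\<^esub> g) i\<parallel>\<^bsub>Z i\<^esub> = \<delta> i (f i) (g i)"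
    using eventually_net_mem
    by eventually_elim (simp add: S.minus_eq_smult f g co_Cauchy_family_mem
        seminormed_space.minus_eq_smult[OF Z_seminormed])
qed

lemma family_dist_le:
  assumes "co_Cauchy_family f" "co_Cauchy_family g" "\<forall>\<^sub>F i in net. \<delta> i (f i) (g i) \<le> e"
  shows "\<parallel>f \<ominus>\<^bsub>family_space\<^esub> g\<parallel>\<^bsub>family_space\<^esub> \<le> e"
  by (rule tendsto_upperbound[OF family_dist_tendsto assms(3) net_filter_neq_bot])
    (fact assms directed)+

lemma null_rel_family_space:
  "null_rel family_space = {(f, g). co_Cauchy_family f \<and> co_Cauchy_family g \<and>
     ((\<lambda>i. \<delta> i (f i) (g i)) \<longlongrightarrow> 0) net}"
proof -
  have "\<parallel>f \<ominus>\<^bsub>family_space\<^esub> g\<parallel>\<^bsub>family_space\<^esub> = 0 \<longleftrightarrow> ((\<lambda>i. \<delta> i (f i) (g i)) \<longlongrightarrow> 0) net"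
    if "co_Cauchy_family f" "co_Cauchy_family g" for f g
  proof
    assume "\<parallel>f \<ominus>\<^bsub>family_space\<^esub> g\<parallel>\<^bsub>family_space\<^esub> = 0"
    then show "((\<lambda>i. \<delta> i (f i) (g i)) \<longlongrightarrow> 0) net"
      using family_dist_tendsto[OF that] by simp
  qed (rule tendsto_unique[OF net_filter_neq_bot[OF directed] family_dist_tendsto[OF that]])
  then show ?thesis unfolding null_rel_def family_space_simps(1) by blast
qed

lemma null_class_family_eqI:
  assumes f: "co_Cauchy_family f" and g: "co_Cauchy_family g"
    and l: "l \<in> I" "\<And>j. j \<in> I \<Longrightarrow> leq l j \<Longrightarrow> f j = g j"
  shows "null_class family_space f = null_class family_space g"
proof -
  have "\<parallel>f \<ominus>\<^bsub>family_space\<^esub> g\<parallel>\<^bsub>family_space\<^esub> \<le> 0"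
    using l co_Cauchy_family_mem[OF g]
    by (intro family_dist_le f g eventually_net_filterI[OF directed]) (auto simp: \<delta>_self)
  then show ?thesis
    using S.dist_nonneg[of f g] f g by (simp add: S.null_class_eq_iff)
qed

text \<open>The density statement behind uniqueness: the class of \<open>f\<close> is the net limit of the images of
  its components, since the distance to the \<open>i\<close>-th one is the limit over \<open>j\<close> of the co-Cauchy differences.\<close>

lemma extend_family_approx:
  assumes f: "co_Cauchy_family f" and "0 < e"
  obtains l where "l \<in> I"
    "\<And>i. i \<in> I \<Longrightarrow> leq l i \<Longrightarrow> \<parallel>f \<ominus>\<^bsub>family_space\<^esub> extend_family i (f i)\<parallel>\<^bsub>family_space\<^esub> \<le> e"
proof -
  obtain l where l: "l \<in> I"
    "\<And>i j. i \<in> I \<Longrightarrow> j \<in> I \<Longrightarrow> leq l i \<Longrightarrow> leq i j \<Longrightarrow> \<delta> j (\<phi> i j (f i)) (f j) < e"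
    using co_Cauchy_familyE[OF assms] by metis
  have "\<parallel>f \<ominus>\<^bsub>family_space\<^esub> extend_family i (f i)\<parallel>\<^bsub>family_space\<^esub> \<le> e"
    if i: "i \<in> I" "leq l i" for i
  proof (intro family_dist_le f co_Cauchy_family_extend i co_Cauchy_family_mem
      eventually_net_filterI[OF directed i(1)])
    fix j assume j: "j \<in> I" "leq i j"
    then show "\<delta> j (f j) (extend_family i (f i) j) \<le> e"
      using l(2)[OF i(1) j(1) i(2) j(2)] i co_Cauchy_family_mem[OF f]
      by (simp add: extend_family_def \<delta>_commute[of j "f j"] \<phi>_closed)
  qed
  with l(1) show thesis by (rule that)
qed

lemma linear_isometry_extend_family:
  assumes i: "i \<in> I"
  shows "linear_isometry (Z i) (null_quotient family_space)
    (\<lambda>z. null_class family_space (extend_family i z))"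
proof (rule linear_isometry_comp[OF _ S.linear_isometry_null_class])
  show "linear_isometry (Z i) family_space (extend_family i)"
    unfolding linear_isometry_def
  proof (intro conjI ballI allI funcsetI)
    fix z assume z: "z \<in> carrier (Z i)"
    show "extend_family i z \<in> carrier family_space"
      by (simp add: co_Cauchy_family_extend[OF i z])
    have "((\<lambda>j. \<parallel>extend_family i z j\<parallel>\<^bsub>Z j\<^esub>) \<longlongrightarrow> \<parallel>z\<parallel>\<^bsub>Z i\<^esub>) net"
      using i z by (intro tendsto_eventually eventually_net_filterI[OF directed i])
        (simp add: extend_family_def \<phi>_linear)
    then show "\<parallel>extend_family i z\<parallel>\<^bsub>family_space\<^esub> = \<parallel>z\<parallel>\<^bsub>Z i\<^esub>"
      by (rule tendsto_unique[OF net_filter_neq_bot[OF directed]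
            family_nrm_tendsto[OF co_Cauchy_family_extend[OF i z]]])
    have zero: "c \<odot>\<^bsub>Z j\<^esub> \<zero>\<^bsub>Z j\<^esub> = \<zero>\<^bsub>Z j\<^esub>" "\<zero>\<^bsub>Z j\<^esub> \<oplus>\<^bsub>Z j\<^esub> \<zero>\<^bsub>Z j\<^esub> = \<zero>\<^bsub>Z j\<^esub>" if "j \<in> I" for j c
    proof -
      interpret Zj: seminormed_space "Z j" by (rule Z_seminormed[OF that])
      show "c \<odot>\<^bsub>Z j\<^esub> \<zero>\<^bsub>Z j\<^esub> = \<zero>\<^bsub>Z j\<^esub>" "\<zero>\<^bsub>Z j\<^esub> \<oplus>\<^bsub>Z j\<^esub> \<zero>\<^bsub>Z j\<^esub> = \<zero>\<^bsub>Z j\<^esub>"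
        using Zj.smult_r_null[of c] by simp_all
    qed
    show "extend_family i (c \<odot>\<^bsub>Z i\<^esub> z) = c \<odot>\<^bsub>family_space\<^esub> extend_family i z" for c
      using i z by (auto simp: extend_family_def \<phi>_linear zero intro!: restrict_ext)
    fix w assume w: "w \<in> carrier (Z i)"
    show "extend_family i (z \<oplus>\<^bsub>Z i\<^esub> w) =
        extend_family i z \<oplus>\<^bsub>family_space\<^esub> extend_family i w"
      using i z w by (auto simp: extend_family_def \<phi>_linear zero intro!: restrict_ext)
  qed
qed

text \<open>A family within \<open>1 / (n + 1)\<close> of \<open>F n\<close> is obtained by extending the single vector
  \<open>z n = F n (a n)\<close> from a late index \<open>a n\<close>. The \<open>z n\<close> form a Cauchy sequence wherever they can be compared
  (\<open>z_Cauchy\<close>), with bounds that do not depend on the place of comparison as the \<open>\<phi> i j\<close> are isometries.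
  This uniformity is what turns a pointwise choice of \<open>g j\<close> into a co-Cauchy family.\<close>

lemma seq_complete_family_space: "seq_complete family_space"
  unfolding seq_complete_def
proof (intro allI impI)
  fix F :: "nat \<Rightarrow> 'i \<Rightarrow> 'z"
  assume "range F \<subseteq> carrier family_space"
  then have "F n \<in> carrier family_space" for n by blast
  then have F: "co_Cauchy_family (F n)" for n by simp
  assume Cauchy: "\<forall>e>0. \<exists>N. \<forall>m\<ge>N. \<forall>n\<ge>N. \<parallel>F m \<ominus>\<^bsub>family_space\<^esub> F n\<parallel>\<^bsub>family_space\<^esub> < e"
  note Fi = co_Cauchy_family_mem[OF F]
  \<comment> \<open>The indices from which \<open>F n\<close> is co-Cauchy up to \<open>1 / (n + 1)\<close>. They are closed upwards, so the \<open>a n\<close>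
    can be chosen increasing.\<close>
  define good where "good n l \<longleftrightarrow> l \<in> I \<and> (\<forall>i\<in>I. \<forall>j\<in>I. leq l i \<longrightarrow> leq i j \<longrightarrow>
    \<delta> j (\<phi> i j (F n i)) (F n j) < inverse (real (Suc n)))" for n l
  have good: "\<exists>l. good n l \<and> leq k l" if k: "k \<in> I" for n k
  proof -
    have "0 < inverse (real (Suc n))" by simp
    then obtain l where l: "l \<in> I" "\<And>i j. i \<in> I \<Longrightarrow> j \<in> I \<Longrightarrow> leq l i \<Longrightarrow> leq i j \<Longrightarrow>
        \<delta> j (\<phi> i j (F n i)) (F n j) < inverse (real (Suc n))"
      using co_Cauchy_familyE[OF F] by metis
    obtain m where m: "m \<in> I" "leq l m" "leq k m" by (rule upper_bound[OF l(1) k])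
    have "good n m"
      unfolding good_def using m l leq_trans[OF l(1) m(1) _ m(2)] by blast
    with m(3) show ?thesis by blast
  qed
  have "\<exists>a. \<forall>n. good n (a n) \<and> leq (a n) (a (Suc n))"
  proof (rule dependent_nat_choice)
    obtain k where "k \<in> I" using directed by (auto simp: directed_set_def)
    then show "\<exists>l. good 0 l" using good by blast
    show "\<exists>l'. good (Suc n) l' \<and> leq l l'" if "good n l" for n l
      using good that unfolding good_def by blast
  qed
  then obtain a where "\<And>n. good n (a n)" and a_Suc: "\<And>n. leq (a n) (a (Suc n))" by blast
  then have a: "a n \<in> I" and a_approx: "i \<in> I \<Longrightarrow> j \<in> I \<Longrightarrow> leq (a n) i \<Longrightarrow> leq i j \<Longrightarrow>
      \<delta> j (\<phi> i j (F n i)) (F n j) < inverse (real (Suc n))" for n i j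
    unfolding good_def by blast+
  have a_mono: "leq (a m) (a n)" if "m \<le> n" for m n
    using that
  proof (induction n rule: dec_induct)
    case base
    show ?case by (rule leq_refl[OF a])
  next
    case (step k)
    show ?case by (rule leq_trans[OF a a a step.IH a_Suc])
  qed
  define z where "z n = F n (a n)" for n
  have z: "z n \<in> carrier (Z (a n))" for n unfolding z_def by (rule Fi[OF a])
  have \<phi>z: "\<phi> (a n) j (z n) \<in> carrier (Z j)" if "j \<in> I" "leq (a n) j" for n j
    using that a z by (intro \<phi>_closed)
  have z_approx: "\<delta> j (F n j) (\<phi> (a n) j (z n)) < inverse (real (Suc n))"
    if "j \<in> I" "leq (a n) j" for n j
    using a_approx[OF a that(1) leq_refl[OF a] that(2)] that Fi \<phi>z[OF that]
    by (simp add: z_def \<delta>_commute[OF that(1)])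
  have small: "\<exists>N. \<forall>n\<ge>N. inverse (real (Suc n)) < e" if "0 < e" for e
    using order_tendstoD(2)[OF LIMSEQ_inverse_real_of_nat \<open>0 < e\<close>]
    by (simp add: eventually_sequentially)
  have z_Cauchy: "\<exists>N. \<forall>m\<ge>N. \<forall>n\<ge>N. \<forall>j\<in>I. leq (a m) j \<longrightarrow> leq (a n) j \<longrightarrow>
      \<delta> j (\<phi> (a m) j (z m)) (\<phi> (a n) j (z n)) < e" if "0 < e" for e
  proof -
    obtain N where N: "\<And>n. N \<le> n \<Longrightarrow> inverse (real (Suc n)) < e / 3"
      using small[of "e / 3"] \<open>0 < e\<close> by auto
    obtain M where M: "\<And>m n. M \<le> m \<Longrightarrow> M \<le> n \<Longrightarrow>
        \<parallel>F m \<ominus>\<^bsub>family_space\<^esub> F n\<parallel>\<^bsub>family_space\<^esub> < e / 3"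
      using Cauchy[rule_format, of "e / 3"] \<open>0 < e\<close> by auto
    have "\<delta> j (\<phi> (a m) j (z m)) (\<phi> (a n) j (z n)) < e"
      if mn: "N \<le> m" "N \<le> n" "M \<le> m" "M \<le> n" and j: "j \<in> I" "leq (a m) j" "leq (a n) j" for m n j
    proof -
      \<comment> \<open>The norms of \<open>F m - F n\<close> control the components only at late indices \<open>k\<close>; the isometry from \<open>j\<close>
        to such a \<open>k\<close> transports the estimate back to \<open>j\<close>.\<close>
      have "\<forall>\<^sub>F k in net. \<delta> k (F m k) (F n k) < e / 3"
        using order_tendstoD(2)[OF family_dist_tendsto[OF F F] M[OF mn(3,4)]] .
      then obtain l where l: "l \<in> I" "\<And>k. k \<in> I \<Longrightarrow> leq l k \<Longrightarrow> \<delta> k (F m k) (F n k) < e / 3"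
        unfolding eventually_net_filter[OF directed] by blast
      obtain k where k: "k \<in> I" "leq j k" "leq l k" by (rule upper_bound[OF j(1) l(1)])
      have ak: "leq (a m) k" "leq (a n) k"
        using leq_trans[OF a j(1) k(1) _ k(2)] j(2,3) by auto
      have "\<delta> j (\<phi> (a m) j (z m)) (\<phi> (a n) j (z n)) =
          \<delta> k (\<phi> j k (\<phi> (a m) j (z m))) (\<phi> j k (\<phi> (a n) j (z n)))"
        by (rule \<phi>_dist[OF j(1) k(1,2) \<phi>z[OF j(1,2)] \<phi>z[OF j(1,3)], symmetric])
      also have "\<dots> = \<delta> k (\<phi> (a m) k (z m)) (\<phi> (a n) k (z n))"
        by (simp only: \<phi>_comp[OF a j(1) k(1) j(2) k(2) z] \<phi>_comp[OF a j(1) k(1) j(3) k(2) z])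
      also have "\<dots> < e"
        using \<delta>_triangle[OF k(1) \<phi>z[OF k(1) ak(1)] Fi[OF k(1), of m] \<phi>z[OF k(1) ak(2)]]
          \<delta>_triangle[OF k(1) Fi[OF k(1), of m] Fi[OF k(1), of n] \<phi>z[OF k(1) ak(2)]]
          \<delta>_commute[OF k(1) \<phi>z[OF k(1) ak(1)] Fi[OF k(1), of m]]
          z_approx[OF k(1) ak(1)] z_approx[OF k(1) ak(2)] l(2)[OF k(1,3)] N[OF mn(1)] N[OF mn(2)]
        by linarith
      finally show ?thesis .
    qed
    then show ?thesis by (intro exI[of _ "max N M"]) auto
  qed
  \<comment> \<open>The conclusion also records that \<open>j\<close> eventually lies above \<open>a n\<close>, without which \<open>\<phi> (a n) j\<close> would be
    meaningless.\<close>
  have "\<exists>g\<in>(\<Pi>\<^sub>E i\<in>I. carrier (Z i)). \<forall>e>0. \<exists>N. \<forall>n\<ge>N.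
      \<forall>\<^sub>F j in net. leq (a n) j \<and> \<delta> j (\<phi> (a n) j (z n)) (g j) < e"
  proof (cases "\<exists>b\<in>I. \<forall>n. leq (a n) b")
    case True
    then obtain b where b: "b \<in> I" "\<And>n. leq (a n) b" by blast
    have "\<exists>N. \<forall>m\<ge>N. \<forall>n\<ge>N. \<delta> b (\<phi> (a m) b (z m)) (\<phi> (a n) b (z n)) < e" if "0 < e" for e
      using z_Cauchy[OF that] b by blast
    then obtain w where w: "w \<in> carrier (Z b)" "(\<lambda>n. \<delta> b (\<phi> (a n) b (z n)) w) \<longlonglongrightarrow> 0"
      using Z_seq_complete[OF b(1), unfolded seq_complete_def, rule_format,
          of "\<lambda>n. \<phi> (a n) b (z n)"] \<phi>z[OF b] by blast
    show ?thesis
    proof (intro bexI allI impI)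
      show "extend_family b w \<in> (\<Pi>\<^sub>E i\<in>I. carrier (Z i))"
        using co_Cauchy_family_extend[OF b(1) w(1)] by (simp add: co_Cauchy_family_def)
      fix e :: real assume "0 < e"
      then obtain N where N: "\<And>n. N \<le> n \<Longrightarrow> \<delta> b (\<phi> (a n) b (z n)) w < e"
        using order_tendstoD(2)[OF w(2)] by (auto simp: eventually_sequentially)
      show "\<exists>N. \<forall>n\<ge>N. \<forall>\<^sub>F j in net. leq (a n) j \<and>
          \<delta> j (\<phi> (a n) j (z n)) (extend_family b w j) < e"
      proof (intro exI allI impI eventually_net_filterI[OF directed b(1)] conjI)
        fix n j assume n: "N \<le> n" and j: "j \<in> I" "leq b j"
        show "leq (a n) j" by (rule leq_trans[OF a b(1) j(1) b(2) j(2)])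
        show "\<delta> j (\<phi> (a n) j (z n)) (extend_family b w j) < e"
          using N[OF n] \<phi>_dist[OF b(1) j \<phi>z[OF b] w(1), of n]
          by (simp add: extend_family_def j \<phi>_comp[OF a b(1) j(1) b(2) j(2) z])
      qed
    qed
  next
    case False
    then have unbounded: "\<exists>n. \<not> leq (a n) j" if "j \<in> I" for j using that by blast
    \<comment> \<open>As the \<open>a n\<close> increase, \<open>\<nu> j\<close> is the number of those \<open>a n\<close> that lie below \<open>j\<close>. So \<open>\<nu> j - 1\<close> is the
      last \<open>n\<close> that can be seen from \<open>j\<close>, unless \<open>\<nu> j = 0\<close>.\<close>
    define \<nu> where "\<nu> j = (LEAST n. \<not> leq (a n) j)" for j
    define g where "g = (\<lambda>j\<in>I. if \<nu> j = 0 then \<zero>\<^bsub>Z j\<^esub> else \<phi> (a (\<nu> j - 1)) j (z (\<nu> j - 1)))"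
    have below: "leq (a n) j" if "n < \<nu> j" for n j
      using not_less_Least that unfolding \<nu>_def by blast
    have above: "n < \<nu> j" if "j \<in> I" "leq (a n) j" for n j
    proof (rule ccontr)
      assume "\<not> n < \<nu> j"
      then have "leq (a (\<nu> j)) j"
        using leq_trans[OF a a that(1) a_mono that(2)] by simp
      moreover have "\<not> leq (a (\<nu> j)) j"
        unfolding \<nu>_def by (rule LeastI_ex[OF unbounded[OF that(1)]])
      ultimately show False by blast
    qed
    show ?thesis
    proof (intro bexI allI impI)
      show "g \<in> (\<Pi>\<^sub>E i\<in>I. carrier (Z i))"
      proof (rule PiE_I)
        fix j assume j: "j \<in> I"
        interpret Zj: seminormed_space "Z j" by (rule Z_seminormed[OF j])
        show "g j \<in> carrier (Z j)"
          using \<phi>z[OF j below[of "\<nu> j - 1" j]] j by (simp add: g_def)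
      qed (simp add: g_def)
      fix e :: real assume "0 < e"
      then obtain N where N: "\<And>m n j. N \<le> m \<Longrightarrow> N \<le> n \<Longrightarrow> j \<in> I \<Longrightarrow> leq (a m) j \<Longrightarrow> leq (a n) j \<Longrightarrow>
          \<delta> j (\<phi> (a m) j (z m)) (\<phi> (a n) j (z n)) < e"
        using z_Cauchy by metis
      show "\<exists>N. \<forall>n\<ge>N. \<forall>\<^sub>F j in net. leq (a n) j \<and> \<delta> j (\<phi> (a n) j (z n)) (g j) < e"
      proof (intro exI allI impI eventually_net_filterI[OF directed a] conjI)
        fix n j assume n: "N \<le> n" and j: "j \<in> I" "leq (a n) j"
        show "leq (a n) j" by fact
        have \<nu>: "n < \<nu> j" by (rule above[OF j])
        then show "\<delta> j (\<phi> (a n) j (z n)) (g j) < e"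
          using N[OF n _ j(1,2) below[of "\<nu> j - 1" j]] n j(1) by (simp add: g_def)
      qed
    qed
  qed
  then obtain g where g: "g \<in> (\<Pi>\<^sub>E i\<in>I. carrier (Z i))" and lim: "\<And>e. 0 < e \<Longrightarrow> \<exists>N. \<forall>n\<ge>N.
      \<forall>\<^sub>F j in net. leq (a n) j \<and> \<delta> j (\<phi> (a n) j (z n)) (g j) < e"
    by blast
  have F_lim: "\<exists>N. \<forall>n\<ge>N. \<forall>\<^sub>F j in net. \<delta> j (F n j) (g j) < e" if "0 < e" for e
  proof -
    obtain N where N: "\<And>n. N \<le> n \<Longrightarrow> inverse (real (Suc n)) < e / 2"
      using small[of "e / 2"] \<open>0 < e\<close> by auto
    obtain M where M: "\<And>n. M \<le> n \<Longrightarrow>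
        \<forall>\<^sub>F j in net. leq (a n) j \<and> \<delta> j (\<phi> (a n) j (z n)) (g j) < e / 2"
      using lim[of "e / 2"] \<open>0 < e\<close> by auto
    have "\<forall>\<^sub>F j in net. \<delta> j (F n j) (g j) < e" if n: "N \<le> n" "M \<le> n" for n
      using M[OF n(2)] eventually_net_mem
    proof eventually_elim
      case (elim j)
      then have j: "j \<in> I" "leq (a n) j" and close: "\<delta> j (\<phi> (a n) j (z n)) (g j) < e / 2"
        by simp_all
      then have "g j \<in> carrier (Z j)" using g by auto
      then show ?case
        using \<delta>_triangle[OF j(1) Fi[OF j(1), of n] \<phi>z[OF j]] z_approx[OF j] N[OF n(1)] close
        by fastforce
    qed
    then show ?thesis by (intro exI[of _ "max N M"]) auto
  qed
  have g': "co_Cauchy_family g"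
    unfolding co_Cauchy_family_def
  proof (intro conjI g allI impI)
    fix e :: real assume "0 < e"
    then have e: "0 < e / 3" by simp
    obtain n where "\<forall>\<^sub>F j in net. \<delta> j (F n j) (g j) < e / 3"
      using F_lim[OF e] by blast
    then obtain l where l: "l \<in> I" "\<And>j. j \<in> I \<Longrightarrow> leq l j \<Longrightarrow> \<delta> j (F n j) (g j) < e / 3"
      unfolding eventually_net_filter[OF directed] by blast
    obtain m where m: "m \<in> I" "\<And>i j. i \<in> I \<Longrightarrow> j \<in> I \<Longrightarrow> leq m i \<Longrightarrow> leq i j \<Longrightarrow>
        \<delta> j (\<phi> i j (F n i)) (F n j) < e / 3"
      using co_Cauchy_familyE[OF F e] by metis
    obtain k where k: "k \<in> I" "leq l k" "leq m k" by (rule upper_bound[OF l(1) m(1)])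
    have "\<delta> j (\<phi> i j (g i)) (g j) < e" if ij: "i \<in> I" "j \<in> I" "leq k i" "leq i j" for i j
    proof -
      have li: "leq l i" by (rule leq_trans[OF l(1) k(1) ij(1) k(2) ij(3)])
      have lj: "leq l j" by (rule leq_trans[OF l(1) ij(1,2) li ij(4)])
      have mi: "leq m i" by (rule leq_trans[OF m(1) k(1) ij(1) k(3) ij(3)])
      have gi: "g i \<in> carrier (Z i)" and gj: "g j \<in> carrier (Z j)" using g ij by auto
      note gi' = \<phi>_closed[OF ij(1,2,4) gi] and Fi' = \<phi>_closed[OF ij(1,2,4) Fi[OF ij(1), of n]]
      show ?thesis
        using \<delta>_triangle[OF ij(2) gi' Fi' gj] \<delta>_triangle[OF ij(2) Fi' Fi[OF ij(2), of n] gj]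
          \<phi>_dist[OF ij(1,2,4) gi Fi[OF ij(1), of n]] \<delta>_commute[OF ij(1) gi Fi[OF ij(1), of n]]
          l(2)[OF ij(1) li] l(2)[OF ij(2) lj] m(2)[OF ij(1,2) mi ij(4)]
        by linarith
    qed
    then show "\<exists>l\<in>I. \<forall>i\<in>I. \<forall>j\<in>I. leq l i \<longrightarrow> leq i j \<longrightarrow> \<delta> j (\<phi> i j (g i)) (g j) < e"
      using k(1) by blast
  qed
  have "(\<lambda>n. \<parallel>F n \<ominus>\<^bsub>family_space\<^esub> g\<parallel>\<^bsub>family_space\<^esub>) \<longlonglongrightarrow> 0"
  proof (rule LIMSEQ_I)
    fix e :: real assume "0 < e"
    then obtain N where N: "\<And>n. N \<le> n \<Longrightarrow> \<forall>\<^sub>F j in net. \<delta> j (F n j) (g j) < e / 2"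
      using F_lim[of "e / 2"] by auto
    have "\<parallel>F n \<ominus>\<^bsub>family_space\<^esub> g\<parallel>\<^bsub>family_space\<^esub> \<le> e / 2" if "N \<le> n" for n
      using N[OF that] by (intro family_dist_le F g') (auto elim: eventually_mono)
    then show "\<exists>N. \<forall>n\<ge>N. norm (\<parallel>F n \<ominus>\<^bsub>family_space\<^esub> g\<parallel>\<^bsub>family_space\<^esub> - 0) < e"
      using \<open>0 < e\<close> S.dist_nonneg[of "F _" g] F g' by (intro exI[of _ N]) fastforce
  qed
  with g' show "\<exists>g\<in>carrier family_space.
      (\<lambda>n. \<parallel>F n \<ominus>\<^bsub>family_space\<^esub> g\<parallel>\<^bsub>family_space\<^esub>) \<longlonglongrightarrow> 0"
    by (intro bexI[of _ g]) simp_all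
qed

lemma ban_cocone_family_space:
  "ban_cocone I leq Z \<phi> (null_quotient family_space)
     (\<lambda>i z. null_class family_space (extend_family i z))"
  unfolding ban_cocone_def
proof (intro conjI ballI impI)
  show "banach_space (null_quotient family_space)"
    by (rule S.seq_complete_null_quotient[OF seq_complete_family_space])
  fix i assume i: "i \<in> I"
  show "linear_isometry (Z i) (null_quotient family_space)
      (\<lambda>z. null_class family_space (extend_family i z))"
    by (rule linear_isometry_extend_family[OF i])
  fix j z assume j: "j \<in> I" "leq i j" and z: "z \<in> carrier (Z i)"
  show "null_class family_space (extend_family i z) =
      null_class family_space (extend_family j (\<phi> i j z))"
  proof (rule null_class_family_eqI[OF _ _ j(1)])
    fix k assume k: "k \<in> I" "leq j k"
    have "leq i k" by (rule leq_trans[OF i j(1) k(1) j(2) k(2)])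
    then show "extend_family i z k = extend_family j (\<phi> i j z) k"
      using k \<phi>_comp[OF i j(1) k(1) j(2) k(2) z] by (simp add: extend_family_def)
  qed (intro co_Cauchy_family_extend i j z \<phi>_closed)+
qed

text \<open>Compatibility of the cocone turns differences \<open>\<rho> l (f l) - \<rho> j (f j)\<close> into the co-Cauchy
  differences of \<open>f\<close>, measured at the index \<open>j\<close>.\<close>

lemma cocone_net_limit:
  assumes cocone: "ban_cocone I leq Z \<phi> W \<rho>" and f: "co_Cauchy_family f"
  shows "\<exists>!y. y \<in> carrier W \<and> ((\<lambda>i. \<parallel>\<rho> i (f i) \<ominus>\<^bsub>W\<^esub> y\<parallel>\<^bsub>W\<^esub>) \<longlongrightarrow> 0) net"
proof -
  interpret W: banach_space W using cocone unfolding ban_cocone_def by blast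
  have \<rho>: "linear_isometry (Z i) W (\<rho> i)" if "i \<in> I" for i
    using cocone that unfolding ban_cocone_def by blast
  have \<rho>f: "\<rho> i (f i) \<in> carrier W" if "i \<in> I" for i
    using \<rho>[OF that] co_Cauchy_family_mem[OF f that] unfolding linear_isometry_def by blast
  have "\<exists>y\<in>carrier W. ((\<lambda>i. \<parallel>\<rho> i (f i) \<ominus>\<^bsub>W\<^esub> y\<parallel>\<^bsub>W\<^esub>) \<longlongrightarrow> 0) net"
  proof (rule W.Cauchy_net_converges[OF _ directed \<rho>f])
    show "seq_complete W" using W.banach_space_axioms by (simp add: banach_space_iff)
    fix e :: real assume "0 < e"
    then obtain l where l: "l \<in> I"
      "\<And>i j. i \<in> I \<Longrightarrow> j \<in> I \<Longrightarrow> leq l i \<Longrightarrow> leq i j \<Longrightarrow> \<delta> j (\<phi> i j (f i)) (f j) < e"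
      using co_Cauchy_familyE[OF f] by metis
    have "\<parallel>\<rho> l (f l) \<ominus>\<^bsub>W\<^esub> \<rho> j (f j)\<parallel>\<^bsub>W\<^esub> < e" if j: "j \<in> I" "leq l j" for j
    proof -
      have fl: "f l \<in> carrier (Z l)" and fj: "f j \<in> carrier (Z j)"
        using co_Cauchy_family_mem[OF f] l(1) j(1) by auto
      have "\<rho> l (f l) = \<rho> j (\<phi> l j (f l))"
        using cocone l(1) j fl unfolding ban_cocone_def by blast
      then show ?thesis
        using linear_isometry_dist[OF Z_seminormed[OF j(1)] W.seminormed_space_axioms \<rho>[OF j(1)]
            \<phi>_closed[OF l(1) j fl] fj] l(2)[OF l(1) j(1) leq_refl[OF l(1)] j(2)] by simp
    qed
    with l(1) show "\<exists>l\<in>I. \<forall>j\<in>I. leq l j \<longrightarrow> \<parallel>\<rho> l (f l) \<ominus>\<^bsub>W\<^esub> \<rho> j (f j)\<parallel>\<^bsub>W\<^esub> < e" by blast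
  qed
  moreover have "\<forall>\<^sub>F i in net. \<rho> i (f i) \<in> carrier W"
    using eventually_net_mem by eventually_elim (rule \<rho>f)
  ultimately show ?thesis
    using W.net_limit_unique[OF net_filter_neq_bot[OF directed], of _ _ "\<lambda>i. \<rho> i (f i)"] by blast
qed

text \<open>The comparison map sends the class of \<open>f\<close> to the net limit of \<open>\<rho> i (f i)\<close>, which passes to
  classes because it preserves the seminorm. Any other candidate \<open>\<Psi>\<close> has the same value, since
  \<open>\<rho> i (f i) = \<Psi> (\<psi> i (f i))\<close> and \<open>\<psi> i (f i)\<close> tends to the class of \<open>f\<close>.\<close>

theorem ban_colimit_family_space:
  "ban_colimit TYPE('w) I leq Z \<phi> (null_quotient family_space)
     (\<lambda>i z. null_class family_space (extend_family i z))"
  unfolding ban_colimit_def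
proof (intro conjI allI impI codiagram ban_cocone_family_space)
  let ?Q = "null_quotient family_space" and ?\<psi> = "\<lambda>i z. null_class family_space (extend_family i z)"
  interpret Q: normed_space ?Q by (rule S.normed_space_null_quotient)
  fix W :: "'w normed" and \<rho>
  assume cocone: "ban_cocone I leq Z \<phi> W \<rho>"
  interpret W: banach_space W using cocone unfolding ban_cocone_def by blast
  have \<rho>: "linear_isometry (Z i) W (\<rho> i)" if "i \<in> I" for i
    using cocone that unfolding ban_cocone_def by blast
  have \<rho>_closed: "\<rho> i x \<in> carrier W" if "i \<in> I" "x \<in> carrier (Z i)" for i x
    using \<rho>[OF that(1)] that(2) unfolding linear_isometry_def by blast
  define L where "L f = (THE y. y \<in> carrier W \<and>
    ((\<lambda>i. \<parallel>\<rho> i (f i) \<ominus>\<^bsub>W\<^esub> y\<parallel>\<^bsub>W\<^esub>) \<longlongrightarrow> 0) net)" for f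
  have L: "L f \<in> carrier W" "((\<lambda>i. \<parallel>\<rho> i (f i) \<ominus>\<^bsub>W\<^esub> L f\<parallel>\<^bsub>W\<^esub>) \<longlongrightarrow> 0) net"
    if "co_Cauchy_family f" for f
    using theI'[OF cocone_net_limit[OF cocone that]] by (auto simp: L_def)
  have L_eqI: "L f = y" if "co_Cauchy_family f" "y \<in> carrier W"
    "((\<lambda>i. \<parallel>\<rho> i (f i) \<ominus>\<^bsub>W\<^esub> y\<parallel>\<^bsub>W\<^esub>) \<longlongrightarrow> 0) net" for f y
    using cocone_net_limit[OF cocone that(1)] L[OF that(1)] that(2,3) by blast
  have L_isometry: "linear_isometry family_space W L"
    unfolding linear_isometry_def
  proof (intro conjI ballI allI funcsetI)
    fix f assume "f \<in> carrier family_space"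
    then have f: "co_Cauchy_family f" by simp
    show "L f \<in> carrier W" by (rule L[OF f])
    note fi = co_Cauchy_family_mem[OF f]
    show "L (c \<odot>\<^bsub>family_space\<^esub> f) = c \<odot>\<^bsub>W\<^esub> L f" for c
    proof (rule L_eqI)
      show "co_Cauchy_family (c \<odot>\<^bsub>family_space\<^esub> f)"
        using co_Cauchy_family_smult[OF f] by (simp only: family_space_simps)
      show "c \<odot>\<^bsub>W\<^esub> L f \<in> carrier W" using L[OF f] by simp
      have "\<forall>\<^sub>F i in net. \<bar>c\<bar> * \<parallel>\<rho> i (f i) \<ominus>\<^bsub>W\<^esub> L f\<parallel>\<^bsub>W\<^esub> =
          \<parallel>\<rho> i ((c \<odot>\<^bsub>family_space\<^esub> f) i) \<ominus>\<^bsub>W\<^esub> c \<odot>\<^bsub>W\<^esub> L f\<parallel>\<^bsub>W\<^esub>"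
        using eventually_net_mem
      proof eventually_elim
        case (elim i)
        then have "\<rho> i ((c \<odot>\<^bsub>family_space\<^esub> f) i) = c \<odot>\<^bsub>W\<^esub> \<rho> i (f i)"
          using \<rho>[OF elim] fi[OF elim] by (simp add: linear_isometry_def)
        then show ?case
          by (simp only: W.dist_smult[OF \<rho>_closed[OF elim fi[OF elim]] L(1)[OF f]])
      qed
      then show "((\<lambda>i. \<parallel>\<rho> i ((c \<odot>\<^bsub>family_space\<^esub> f) i) \<ominus>\<^bsub>W\<^esub> c \<odot>\<^bsub>W\<^esub> L f\<parallel>\<^bsub>W\<^esub>) \<longlongrightarrow> 0) net"
        using tendsto_mult_left[OF L(2)[OF f], of "\<bar>c\<bar>"] by (auto elim: Lim_transform_eventually)
    qed
    show "\<parallel>L f\<parallel>\<^bsub>W\<^esub> = \<parallel>f\<parallel>\<^bsub>family_space\<^esub>"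
    proof (rule tendsto_unique[OF net_filter_neq_bot[OF directed] _ family_nrm_tendsto[OF f]])
      have "((\<lambda>i. \<parallel>f i\<parallel>\<^bsub>Z i\<^esub> - \<parallel>L f\<parallel>\<^bsub>W\<^esub>) \<longlongrightarrow> 0) net"
      proof (rule Lim_null_comparison[OF _ L(2)[OF f]])
        show "\<forall>\<^sub>F i in net. norm (\<parallel>f i\<parallel>\<^bsub>Z i\<^esub> - \<parallel>L f\<parallel>\<^bsub>W\<^esub>) \<le> \<parallel>\<rho> i (f i) \<ominus>\<^bsub>W\<^esub> L f\<parallel>\<^bsub>W\<^esub>"
          using eventually_net_mem
        proof eventually_elim
          case (elim i)
          have "\<parallel>\<rho> i (f i)\<parallel>\<^bsub>W\<^esub> = \<parallel>f i\<parallel>\<^bsub>Z i\<^esub>"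
            using \<rho>[OF elim] fi[OF elim] by (simp add: linear_isometry_def)
          then show ?case
            using W.nrm_diff_le[OF \<rho>_closed[OF elim fi[OF elim]] L(1)[OF f]] by simp
        qed
      qed
      then show "((\<lambda>i. \<parallel>f i\<parallel>\<^bsub>Z i\<^esub>) \<longlongrightarrow> \<parallel>L f\<parallel>\<^bsub>W\<^esub>) net" by (rule Lim_null[THEN iffD2])
    qed
    fix g assume "g \<in> carrier family_space"
    then have g: "co_Cauchy_family g" by simp
    note gi = co_Cauchy_family_mem[OF g]
    show "L (f \<oplus>\<^bsub>family_space\<^esub> g) = L f \<oplus>\<^bsub>W\<^esub> L g"
    proof (rule L_eqI)
      show "co_Cauchy_family (f \<oplus>\<^bsub>family_space\<^esub> g)"
        using co_Cauchy_family_add[OF f g] by (simp only: family_space_simps)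
      show "L f \<oplus>\<^bsub>W\<^esub> L g \<in> carrier W" using L[OF f] L[OF g] by simp
      have "((\<lambda>i. \<parallel>\<rho> i (f i) \<ominus>\<^bsub>W\<^esub> L f\<parallel>\<^bsub>W\<^esub> + \<parallel>\<rho> i (g i) \<ominus>\<^bsub>W\<^esub> L g\<parallel>\<^bsub>W\<^esub>) \<longlongrightarrow> 0) net"
        using tendsto_add[OF L(2)[OF f] L(2)[OF g]] by simp
      then show "((\<lambda>i. \<parallel>\<rho> i ((f \<oplus>\<^bsub>family_space\<^esub> g) i) \<ominus>\<^bsub>W\<^esub> (L f \<oplus>\<^bsub>W\<^esub> L g)\<parallel>\<^bsub>W\<^esub>) \<longlongrightarrow> 0) net"
      proof (rule Lim_null_comparison[rotated])
        show "\<forall>\<^sub>F i in net. norm \<parallel>\<rho> i ((f \<oplus>\<^bsub>family_space\<^esub> g) i) \<ominus>\<^bsub>W\<^esub> (L f \<oplus>\<^bsub>W\<^esub> L g)\<parallel>\<^bsub>W\<^esub> \<le>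
            \<parallel>\<rho> i (f i) \<ominus>\<^bsub>W\<^esub> L f\<parallel>\<^bsub>W\<^esub> + \<parallel>\<rho> i (g i) \<ominus>\<^bsub>W\<^esub> L g\<parallel>\<^bsub>W\<^esub>"
          using eventually_net_mem
        proof eventually_elim
          case (elim i)
          have "\<rho> i ((f \<oplus>\<^bsub>family_space\<^esub> g) i) = \<rho> i (f i) \<oplus>\<^bsub>W\<^esub> \<rho> i (g i)"
            using elim \<rho>[OF elim] fi[OF elim] gi[OF elim] by (simp add: linear_isometry_def)
          then show ?case
            using W.dist_add[OF \<rho>_closed[OF elim fi[OF elim]] \<rho>_closed[OF elim gi[OF elim]]
                L(1)[OF f] L(1)[OF g]]
              W.dist_nonneg[of "\<rho> i (f i) \<oplus>\<^bsub>W\<^esub> \<rho> i (g i)" "L f \<oplus>\<^bsub>W\<^esub> L g"]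
              \<rho>_closed[OF elim fi[OF elim]] \<rho>_closed[OF elim gi[OF elim]] L(1)[OF f] L(1)[OF g]
            by simp
        qed
      qed
    qed
  qed
  define \<Phi> where "\<Phi> = (\<lambda>A\<in>carrier ?Q. the_elem (L ` A))"
  have \<Phi>_class: "\<Phi> (null_class family_space f) = L f" if f: "f \<in> carrier family_space" for f
  proof -
    have "L g = L f" if "g \<in> null_class family_space f" for g
    proof -
      have g: "g \<in> carrier family_space" "\<parallel>f \<ominus>\<^bsub>family_space\<^esub> g\<parallel>\<^bsub>family_space\<^esub> = 0"
        using that by (auto simp: null_rel_def)
      have "\<parallel>L f \<ominus>\<^bsub>W\<^esub> L g\<parallel>\<^bsub>W\<^esub> = 0"
        using linear_isometry_dist[OF S.seminormed_space_axioms W.seminormed_space_axioms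
            L_isometry f g(1)] g(2) by simp
      then have "nrm_dist W (L f) (L g) = 0" by (simp add: nrm_dist_def)
      then show ?thesis
        using Metric_space.zero[OF W.Metric_space_nrm_dist, of "L f" "L g"] L(1) f g(1) by simp
    qed
    moreover have "f \<in> null_class family_space f" using f by (simp add: null_rel_def)
    ultimately have "L ` null_class family_space f = {L f}" by blast
    then show ?thesis using S.null_class_in_carrier[OF f] by (simp add: \<Phi>_def)
  qed
  show "\<exists>!\<Phi>. \<Phi> \<in> carrier ?Q \<rightarrow>\<^sub>E carrier W \<and> linear_isometry ?Q W \<Phi> \<and>
      (\<forall>i\<in>I. \<forall>z\<in>carrier (Z i). \<Phi> (?\<psi> i z) = \<rho> i z)"
  proof (rule ex1I[of _ \<Phi>])
    have iso: "linear_isometry ?Q W \<Phi>"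
      by (rule S.linear_isometry_from_null_quotient[OF \<Phi>_class L_isometry])
    have "\<Phi> (?\<psi> i z) = \<rho> i z" if i: "i \<in> I" and z: "z \<in> carrier (Z i)" for i z
    proof -
      have "L (extend_family i z) = \<rho> i z"
      proof (rule L_eqI[OF co_Cauchy_family_extend[OF i z] \<rho>_closed[OF i z]])
        have "\<forall>\<^sub>F j in net. \<parallel>\<rho> j (extend_family i z j) \<ominus>\<^bsub>W\<^esub> \<rho> i z\<parallel>\<^bsub>W\<^esub> = 0"
        proof (rule eventually_net_filterI[OF directed i])
          fix j assume j: "j \<in> I" "leq i j"
          have "\<rho> j (\<phi> i j z) = \<rho> i z"
            using cocone i j z unfolding ban_cocone_def by metis
          then show "\<parallel>\<rho> j (extend_family i z j) \<ominus>\<^bsub>W\<^esub> \<rho> i z\<parallel>\<^bsub>W\<^esub> = 0"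
            using j W.dist_self[OF \<rho>_closed[OF i z]] by (simp add: extend_family_def)
        qed
        then show "((\<lambda>j. \<parallel>\<rho> j (extend_family i z j) \<ominus>\<^bsub>W\<^esub> \<rho> i z\<parallel>\<^bsub>W\<^esub>) \<longlongrightarrow> 0) net"
          by (rule tendsto_eventually)
      qed
      then show ?thesis using \<Phi>_class co_Cauchy_family_extend[OF i z] by simp
    qed
    moreover have "\<Phi> \<in> carrier ?Q \<rightarrow>\<^sub>E carrier W"
      using iso unfolding linear_isometry_def PiE_def by (auto simp only: \<Phi>_def restrict_extensional)
    ultimately show "\<Phi> \<in> carrier ?Q \<rightarrow>\<^sub>E carrier W \<and> linear_isometry ?Q W \<Phi> \<and>
        (\<forall>i\<in>I. \<forall>z\<in>carrier (Z i). \<Phi> (?\<psi> i z) = \<rho> i z)"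
      using iso by blast
  next
    fix \<Psi>
    assume \<Psi>: "\<Psi> \<in> carrier ?Q \<rightarrow>\<^sub>E carrier W \<and> linear_isometry ?Q W \<Psi> \<and>
      (\<forall>i\<in>I. \<forall>z\<in>carrier (Z i). \<Psi> (?\<psi> i z) = \<rho> i z)"
    have \<Psi>_class: "\<Psi> (null_class family_space f) = L f" if "f \<in> carrier family_space" for f
    proof (rule L_eqI[symmetric])
      show f: "co_Cauchy_family f" using that by simp
      note fi = co_Cauchy_family_mem[OF f]
      have fQ: "null_class family_space f \<in> carrier ?Q" by (rule S.null_class_in_carrier[OF that])
      then show closed: "\<Psi> (null_class family_space f) \<in> carrier W" using \<Psi> by blast
      have eq: "\<parallel>\<rho> i (f i) \<ominus>\<^bsub>W\<^esub> \<Psi> (null_class family_space f)\<parallel>\<^bsub>W\<^esub> =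
          \<parallel>f \<ominus>\<^bsub>family_space\<^esub> extend_family i (f i)\<parallel>\<^bsub>family_space\<^esub>" if i: "i \<in> I" for i
      proof -
        have e: "extend_family i (f i) \<in> carrier family_space"
          using co_Cauchy_family_extend[OF i fi[OF i]] by simp
        have "\<rho> i (f i) = \<Psi> (?\<psi> i (f i))" using \<Psi> i fi[OF i] by simp
        then have "\<parallel>\<rho> i (f i) \<ominus>\<^bsub>W\<^esub> \<Psi> (null_class family_space f)\<parallel>\<^bsub>W\<^esub> =
            \<parallel>?\<psi> i (f i) \<ominus>\<^bsub>?Q\<^esub> null_class family_space f\<parallel>\<^bsub>?Q\<^esub>"
          using linear_isometry_dist[OF Q.seminormed_space_axioms W.seminormed_space_axioms _
              S.null_class_in_carrier[OF e] fQ] \<Psi> by simp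
        then show ?thesis
          by (simp only: S.null_quotient_dist[OF e \<open>f \<in> carrier family_space\<close>]
              S.dist_commute[OF e \<open>f \<in> carrier family_space\<close>])
      qed
      show "((\<lambda>i. \<parallel>\<rho> i (f i) \<ominus>\<^bsub>W\<^esub> \<Psi> (null_class family_space f)\<parallel>\<^bsub>W\<^esub>) \<longlongrightarrow> 0) net"
      proof (rule tendstoI)
        fix r :: real assume "0 < r"
        then have "0 < r / 2" by simp
        then obtain l where l: "l \<in> I" "\<And>i. i \<in> I \<Longrightarrow> leq l i \<Longrightarrow>
            \<parallel>f \<ominus>\<^bsub>family_space\<^esub> extend_family i (f i)\<parallel>\<^bsub>family_space\<^esub> \<le> r / 2"
          using extend_family_approx[OF f] by metis
        show "\<forall>\<^sub>F i in net. dist \<parallel>\<rho> i (f i) \<ominus>\<^bsub>W\<^esub> \<Psi> (null_class family_space f)\<parallel>\<^bsub>W\<^esub> 0 < r"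
        proof (rule eventually_net_filterI[OF directed l(1)])
          fix i assume i: "i \<in> I" "leq l i"
          then show "dist \<parallel>\<rho> i (f i) \<ominus>\<^bsub>W\<^esub> \<Psi> (null_class family_space f)\<parallel>\<^bsub>W\<^esub> 0 < r"
            using l(2)[OF i] \<open>0 < r\<close> W.dist_nonneg[OF \<rho>_closed[OF i(1) fi[OF i(1)]] closed]
            by (simp add: eq)
        qed
      qed
    qed
    show "\<Psi> = \<Phi>"
    proof (rule extensionalityI)
      show "\<Psi> \<in> extensional (carrier ?Q)" using \<Psi> by (simp add: PiE_iff)
      show "\<Phi> \<in> extensional (carrier ?Q)" by (simp add: \<Phi>_def)
      fix A assume "A \<in> carrier ?Q"
      then obtain f where "f \<in> carrier family_space" "A = null_class family_space f"
        by (rule S.null_quotientE)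
      then show "\<Psi> A = \<Phi> A" by (simp only: \<Psi>_class \<Phi>_class)
    qed
  qed
qed

end

section \<open>The spaces \<open>L\<^sup>p\<close> as Banach spaces\<close>

text \<open>Convexity of \<open>x \<mapsto> x powr p\<close> at the convex combination
  \<open>(x + y) / (s + t) = s / (s + t) * (x / s) + t / (s + t) * (y / t)\<close>. The weights \<open>s = t = 1\<close> show that
  \<open>L\<^sup>p\<close> is closed under sums; weights close to the two norms give Minkowski's inequality.\<close>

lemma powr_add_le_weighted:
  fixes x y s t p :: real
  assumes "1 \<le> p" "0 \<le> x" "0 \<le> y" "0 < s" "0 < t"
  shows "(x + y) powr p \<le>
    (s + t) powr (p - 1) * (s powr (1 - p) * x powr p + t powr (1 - p) * y powr p)"
proof -
  have single: "z powr p \<le> (a + b) powr (p - 1) * (a powr (1 - p) * z powr p)"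
    if "0 < a" "0 < b" for a b z :: real
  proof -
    have "1 = a powr (p - 1) * a powr (1 - p)"
      using that by (simp flip: powr_add)
    also have "\<dots> \<le> (a + b) powr (p - 1) * a powr (1 - p)"
      using that assms(1) by (intro mult_right_mono powr_mono2) auto
    finally show ?thesis
      using mult_right_mono[of 1 "(a + b) powr (p - 1) * a powr (1 - p)" "z powr p"]
      by (simp add: mult.assoc)
  qed
  consider "x = 0" | "y = 0" | "0 < x" "0 < y" using assms by linarith
  then show ?thesis
  proof cases
    case 1
    then show ?thesis using single[of t s y] assms by (simp add: add.commute)
  next
    case 2
    then show ?thesis using single[of s t x] assms by simp
  next
    case 3
    define u where "u = t / (s + t)"
    have u: "0 \<le> u" "u \<le> 1" "1 - u = s / (s + t)" using assms by (auto simp: u_def field_simps)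
    have "(x + y) / (s + t) = (1 - u) * (x / s) + u * (y / t)"
      using assms u(3) by (simp add: u_def add_divide_distrib)
    then have "((x + y) / (s + t)) powr p \<le> (1 - u) * (x / s) powr p + u * (y / t) powr p"
      using convex_onD[OF powr_convex[OF assms(1)], of u "x / s" "y / t"] u assms 3 by simp
    moreover have "(1 - u) * (x / s) powr p = s powr (1 - p) * x powr p / (s + t)"
      using assms 3 by (simp add: u(3) powr_divide powr_diff)
    moreover have "u * (y / t) powr p = t powr (1 - p) * y powr p / (s + t)"
      using assms 3 by (simp add: u_def powr_divide powr_diff)
    ultimately have "(x + y) powr p \<le> (s + t) powr p *
        (s powr (1 - p) * x powr p / (s + t) + t powr (1 - p) * y powr p / (s + t))"
      using assms 3 by (simp add: powr_divide pos_divide_le_eq mult.commute)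
    also have "\<dots> = (s + t) powr (p - 1) * (s powr (1 - p) * x powr p + t powr (1 - p) * y powr p)"
    proof -
      have "(s + t) powr (p - 1) = (s + t) powr p / (s + t)" using assms by (simp add: powr_diff)
      then show ?thesis
        by (simp only: times_divide_eq_left times_divide_eq_right add_divide_distrib distrib_left)
    qed
    finally show ?thesis .
  qed
qed

lemma Lp_fun_space_simps [simp]:
  "f \<in> carrier (Lp_fun_space p M) \<longleftrightarrow>
     f \<in> borel_measurable M \<and> integrable M (\<lambda>x. \<bar>f x\<bar> powr p)"
  "\<zero>\<^bsub>Lp_fun_space p M\<^esub> = (\<lambda>x. 0)"
  "f \<oplus>\<^bsub>Lp_fun_space p M\<^esub> g = (\<lambda>x. f x + g x)"
  "c \<odot>\<^bsub>Lp_fun_space p M\<^esub> f = (\<lambda>x. c * f x)"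
  by (simp_all add: Lp_fun_space_def)

lemma Lp_nrm_powr:
  assumes "1 \<le> p"
  shows "\<parallel>f\<parallel>\<^bsub>Lp_fun_space p M\<^esub> powr p = (\<integral>x. \<bar>f x\<bar> powr p \<partial>M)"
  using assms by (simp add: Lp_fun_space_def powr_powr)

lemma Lp_nrm_ge_0: "0 \<le> \<parallel>f\<parallel>\<^bsub>Lp_fun_space p M\<^esub>"
  by (simp add: Lp_fun_space_def)

lemma Lp_add_closed:
  assumes "1 \<le> p" "f \<in> carrier (Lp_fun_space p M)" "g \<in> carrier (Lp_fun_space p M)"
  shows "(\<lambda>x. f x + g x) \<in> carrier (Lp_fun_space p M)"
proof -
  have [measurable]: "f \<in> borel_measurable M" "g \<in> borel_measurable M" using assms by auto
  have le: "\<bar>f x + g x\<bar> powr p \<le> 2 powr (p - 1) * (\<bar>f x\<bar> powr p + \<bar>g x\<bar> powr p)" for x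
  proof -
    have "\<bar>f x + g x\<bar> powr p \<le> (\<bar>f x\<bar> + \<bar>g x\<bar>) powr p"
      using assms(1) by (intro powr_mono2) auto
    then show ?thesis
      using powr_add_le_weighted[OF assms(1), of "\<bar>f x\<bar>" "\<bar>g x\<bar>" 1 1] by simp
  qed
  have "integrable M (\<lambda>x. \<bar>f x + g x\<bar> powr p)"
  proof (rule Bochner_Integration.integrable_bound)
    show "integrable M (\<lambda>x. 2 powr (p - 1) * (\<bar>f x\<bar> powr p + \<bar>g x\<bar> powr p))"
      using assms by simp
    show "AE x in M. norm (\<bar>f x + g x\<bar> powr p) \<le>
        norm (2 powr (p - 1) * (\<bar>f x\<bar> powr p + \<bar>g x\<bar> powr p))"
      by (rule AE_I2) (simp add: le)
  qed measurable
  then show ?thesis by simp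
qed

text \<open>The weights in the convexity inequality should be the norms of \<open>f\<close> and \<open>g\<close>. Slightly
  larger ones avoid the degenerate case of norm zero, at the price of an arbitrarily small error.\<close>

lemma Lp_Minkowski:
  assumes "1 \<le> p" "f \<in> carrier (Lp_fun_space p M)" "g \<in> carrier (Lp_fun_space p M)"
  shows "\<parallel>\<lambda>x. f x + g x\<parallel>\<^bsub>Lp_fun_space p M\<^esub> \<le>
    \<parallel>f\<parallel>\<^bsub>Lp_fun_space p M\<^esub> + \<parallel>g\<parallel>\<^bsub>Lp_fun_space p M\<^esub>"
proof (rule field_le_epsilon)
  let ?N = "nrm (Lp_fun_space p M)"
  fix e :: real assume "0 < e"
  \<comment> \<open>With \<open>a \<ge> \<parallel>h\<parallel>\<close> the weighted integral of \<open>h\<close> is at most \<open>a\<close>, so the right-hand side of the weighted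
    inequality integrates to at most \<open>(s + t) powr p\<close>.\<close>
  define s t where "s = ?N f + e / 2" and "t = ?N g + e / 2"
  have st: "0 < s" "0 < t"
    using \<open>0 < e\<close> Lp_nrm_ge_0[of p M f] Lp_nrm_ge_0[of p M g] by (auto simp: s_def t_def)
  have weight: "a powr (1 - p) * (\<integral>x. \<bar>h x\<bar> powr p \<partial>M) \<le> a" if "?N h \<le> a" "0 < a" for a h
  proof -
    have "a powr (1 - p) * (\<integral>x. \<bar>h x\<bar> powr p \<partial>M) \<le> a powr (1 - p) * a powr p"
      using that assms(1) Lp_nrm_ge_0[of p M h]
      by (intro mult_left_mono) (auto simp: powr_mono2 simp flip: Lp_nrm_powr)
    also have "\<dots> = a" using that by (simp flip: powr_add)
    finally show ?thesis .
  qed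
  have int: "integrable M (\<lambda>x. \<bar>f x\<bar> powr p)" "integrable M (\<lambda>x. \<bar>g x\<bar> powr p)"
    using assms by auto
  have "?N (\<lambda>x. f x + g x) powr p = (\<integral>x. \<bar>f x + g x\<bar> powr p \<partial>M)"
    by (rule Lp_nrm_powr[OF assms(1)])
  also have "\<dots> \<le> (\<integral>x. (s + t) powr (p - 1) *
      (s powr (1 - p) * \<bar>f x\<bar> powr p + t powr (1 - p) * \<bar>g x\<bar> powr p) \<partial>M)"
  proof (rule integral_mono)
    fix x
    have "\<bar>f x + g x\<bar> powr p \<le> (\<bar>f x\<bar> + \<bar>g x\<bar>) powr p"
      using assms(1) by (intro powr_mono2) auto
    also note powr_add_le_weighted[OF assms(1) _ _ st, of "\<bar>f x\<bar>" "\<bar>g x\<bar>"]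
    finally show "\<bar>f x + g x\<bar> powr p \<le> (s + t) powr (p - 1) *
        (s powr (1 - p) * \<bar>f x\<bar> powr p + t powr (1 - p) * \<bar>g x\<bar> powr p)" by simp
  qed (use Lp_add_closed[OF assms] int in auto)
  also have "\<dots> = (s + t) powr (p - 1) * (s powr (1 - p) * (\<integral>x. \<bar>f x\<bar> powr p \<partial>M) +
      t powr (1 - p) * (\<integral>x. \<bar>g x\<bar> powr p \<partial>M))"
    using int by simp
  also have "\<dots> \<le> (s + t) powr (p - 1) * (s + t)"
    using st \<open>0 < e\<close> by (intro mult_left_mono add_mono weight) (auto simp: s_def t_def)
  also have "\<dots> = (s + t) powr p"
    using st by (simp add: powr_diff)
  finally have "?N (\<lambda>x. f x + g x) \<le> s + t"
    using powr_less_mono2[of p "s + t" "?N (\<lambda>x. f x + g x)"] assms(1) st by force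
  then show "?N (\<lambda>x. f x + g x) \<le> ?N f + ?N g + e" by (simp add: s_def t_def)
qed

lemma seminormed_space_Lp_fun_space:
  assumes "1 \<le> p"
  shows "seminormed_space (Lp_fun_space p M)"
proof (rule seminormed_spaceI)
  fix c :: real and f :: "'a \<Rightarrow> real"
  show "\<parallel>c \<odot>\<^bsub>Lp_fun_space p M\<^esub> f\<parallel>\<^bsub>Lp_fun_space p M\<^esub> = \<bar>c\<bar> * \<parallel>f\<parallel>\<^bsub>Lp_fun_space p M\<^esub>"
    using assms by (simp add: Lp_fun_space_def abs_mult powr_mult powr_powr)
next
  fix f g assume fg: "f \<in> carrier (Lp_fun_space p M)" "g \<in> carrier (Lp_fun_space p M)"
  show "f \<oplus>\<^bsub>Lp_fun_space p M\<^esub> g \<in> carrier (Lp_fun_space p M)"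
    using Lp_add_closed[OF assms fg] by (simp only: Lp_fun_space_simps(3))
  show "\<parallel>f \<oplus>\<^bsub>Lp_fun_space p M\<^esub> g\<parallel>\<^bsub>Lp_fun_space p M\<^esub> \<le>
      \<parallel>f\<parallel>\<^bsub>Lp_fun_space p M\<^esub> + \<parallel>g\<parallel>\<^bsub>Lp_fun_space p M\<^esub>"
    using Lp_Minkowski[OF assms fg] by (simp only: Lp_fun_space_simps(3))
qed (auto simp: algebra_simps abs_mult powr_mult)

lemma Lp_fun_minus:
  assumes "1 \<le> p" "f \<in> carrier (Lp_fun_space p M)" "g \<in> carrier (Lp_fun_space p M)"
  shows "f \<ominus>\<^bsub>Lp_fun_space p M\<^esub> g = (\<lambda>x. f x - g x)"
  using seminormed_space.minus_eq_smult[OF seminormed_space_Lp_fun_space assms(2,3)] assms(1)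
  by simp

lemma Lp_rel_eq_null_rel:
  assumes "1 \<le> p"
  shows "Lp_rel p M = null_rel (Lp_fun_space p M)"
proof -
  let ?L = "Lp_fun_space p M"
  have "\<parallel>f \<ominus>\<^bsub>?L\<^esub> g\<parallel>\<^bsub>?L\<^esub> = 0 \<longleftrightarrow> (AE x in M. f x = g x)"
    if fg: "f \<in> carrier ?L" "g \<in> carrier ?L" for f g
  proof -
    interpret seminormed_space ?L by (rule seminormed_space_Lp_fun_space[OF assms])
    have "(\<lambda>x. f x - g x) \<in> carrier ?L"
      using minus_closed[OF fg] by (simp only: Lp_fun_minus[OF assms fg])
    then have "(\<integral>x. \<bar>f x - g x\<bar> powr p \<partial>M) = 0 \<longleftrightarrow> (AE x in M. \<bar>f x - g x\<bar> powr p = 0)"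
      by (intro integral_nonneg_eq_0_iff_AE) auto
    then show ?thesis by (simp add: Lp_fun_minus[OF assms fg]) (simp add: Lp_fun_space_def)
  qed
  then show ?thesis unfolding Lp_rel_def null_rel_def by blast
qed

lemma Lp_eq_null_quotient: "1 \<le> p \<Longrightarrow> Lp p M = null_quotient (Lp_fun_space p M)"
  by (simp add: Lp_def Lp_rel_eq_null_rel)

text \<open>Membership in \<open>L\<^sup>p\<close> and a norm bound as one inequality for a nonnegative integral, the form in
  which Fatou's lemma delivers it.\<close>

lemma Lp_nrm_le_iff:
  assumes "1 \<le> p" "0 \<le> e" and [measurable]: "h \<in> borel_measurable M"
  shows "h \<in> carrier (Lp_fun_space p M) \<and> \<parallel>h\<parallel>\<^bsub>Lp_fun_space p M\<^esub> \<le> e \<longleftrightarrow>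
    (\<integral>\<^sup>+x. ennreal (\<bar>h x\<bar> powr p) \<partial>M) \<le> ennreal (e powr p)"
proof -
  have *: "\<parallel>h\<parallel>\<^bsub>Lp_fun_space p M\<^esub> \<le> e \<longleftrightarrow> (\<integral>x. \<bar>h x\<bar> powr p \<partial>M) \<le> e powr p"
    unfolding Lp_nrm_powr[OF assms(1), symmetric]
    using assms powr_mono2[of p "\<parallel>h\<parallel>\<^bsub>Lp_fun_space p M\<^esub>" e]
      powr_less_mono2[of p e "\<parallel>h\<parallel>\<^bsub>Lp_fun_space p M\<^esub>"] Lp_nrm_ge_0[of p M h]
    by (smt (verit))
  show ?thesis
  proof
    assume "h \<in> carrier (Lp_fun_space p M) \<and> \<parallel>h\<parallel>\<^bsub>Lp_fun_space p M\<^esub> \<le> e"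
    then show "(\<integral>\<^sup>+x. ennreal (\<bar>h x\<bar> powr p) \<partial>M) \<le> ennreal (e powr p)"
      using * by (simp add: nn_integral_eq_integral ennreal_leI)
  next
    assume le: "(\<integral>\<^sup>+x. ennreal (\<bar>h x\<bar> powr p) \<partial>M) \<le> ennreal (e powr p)"
    then have int: "integrable M (\<lambda>x. \<bar>h x\<bar> powr p)"
      by (intro integrableI_nonneg) (auto intro: order.strict_trans1)
    then show "h \<in> carrier (Lp_fun_space p M) \<and> \<parallel>h\<parallel>\<^bsub>Lp_fun_space p M\<^esub> \<le> e"
      using le * by (simp add: nn_integral_eq_integral)
  qed
qed

text \<open>From \<open>\<bar>t\<bar> \<le> e + e powr (1 - p) * \<bar>t\<bar> powr p\<close>: either \<open>\<bar>t\<bar> \<le> e\<close> or the second summand is at least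
  \<open>\<bar>t\<bar>\<close>. On a probability space the constant \<open>e\<close> integrates to \<open>e\<close>. The bound is weaker than Jensen's
  inequality by a factor, but enough to pass from Cauchy in \<open>L\<^sup>p\<close> to Cauchy in \<open>L\<^sup>1\<close>.\<close>

lemma (in prob_space) Lp_imp_L1:
  assumes "1 \<le> p" "0 < e" "f \<in> carrier (Lp_fun_space p M)" "\<parallel>f\<parallel>\<^bsub>Lp_fun_space p M\<^esub> \<le> e"
  shows "integrable M f" "(\<integral>x. \<bar>f x\<bar> \<partial>M) \<le> 2 * e"
proof -
  have [measurable]: "f \<in> borel_measurable M" and int: "integrable M (\<lambda>x. \<bar>f x\<bar> powr p)"
    using assms(3) by auto
  have le: "\<bar>f x\<bar> \<le> e + e powr (1 - p) * \<bar>f x\<bar> powr p" for x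
  proof (cases "\<bar>f x\<bar> \<le> e")
    case True
    then show ?thesis by (smt (verit) mult_nonneg_nonneg powr_ge_zero)
  next
    case False
    then have "\<bar>f x\<bar> = \<bar>f x\<bar> powr (1 - p) * \<bar>f x\<bar> powr p"
      using assms(2) by (simp flip: powr_add)
    also have "\<dots> \<le> e powr (1 - p) * \<bar>f x\<bar> powr p"
      using False assms(1,2) by (intro mult_right_mono powr_mono2') auto
    finally show ?thesis using assms(2) by simp
  qed
  have bound: "integrable M (\<lambda>x. e + e powr (1 - p) * \<bar>f x\<bar> powr p)"
    using int by simp
  then show f: "integrable M f"
    by (rule Bochner_Integration.integrable_bound) (auto intro!: AE_I2 order_trans[OF le abs_ge_self])
  have "(\<integral>x. \<bar>f x\<bar> \<partial>M) \<le> (\<integral>x. e + e powr (1 - p) * \<bar>f x\<bar> powr p \<partial>M)"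
    using f bound le by (intro integral_mono) auto
  also have "\<dots> = e + e powr (1 - p) * \<parallel>f\<parallel>\<^bsub>Lp_fun_space p M\<^esub> powr p"
    using int by (simp add: Lp_nrm_powr[OF assms(1)] prob_space)
  also have "\<dots> \<le> e + e powr (1 - p) * e powr p"
    using assms Lp_nrm_ge_0[of p M f]
    by (intro add_left_mono mult_left_mono powr_mono2) auto
  also have "\<dots> = 2 * e" using assms(2) by (simp flip: powr_add)
  finally show "(\<integral>x. \<bar>f x\<bar> \<partial>M) \<le> 2 * e" .
qed

text \<open>A Cauchy sequence in \<open>L\<^sup>p\<close> is Cauchy in \<open>L\<^sup>1\<close>, so a subsequence converges almost everywhere.
  Fatou's lemma along this subsequence carries the Cauchy estimates over to the limit \<open>f\<close>, which shows
  at once that \<open>f\<close> lies in \<open>L\<^sup>p\<close> and that the whole sequence converges to it.\<close>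

theorem (in prob_space) Riesz_Fischer:
  assumes "1 \<le> p"
  shows "seq_complete (Lp_fun_space p M)"
  unfolding seq_complete_def
proof (intro allI impI)
  let ?L = "Lp_fun_space p M"
  interpret L: seminormed_space ?L by (rule seminormed_space_Lp_fun_space[OF assms])
  fix \<sigma> :: "nat \<Rightarrow> 'a \<Rightarrow> real"
  assume "range \<sigma> \<subseteq> carrier ?L"
  then have \<sigma>: "\<sigma> n \<in> carrier ?L" for n by blast
  then have [measurable]: "\<sigma> n \<in> borel_measurable M" for n by simp
  assume "\<forall>e>0. \<exists>N. \<forall>m\<ge>N. \<forall>n\<ge>N. \<parallel>\<sigma> m \<ominus>\<^bsub>?L\<^esub> \<sigma> n\<parallel>\<^bsub>?L\<^esub> < e"
  then have Cauchy: "\<exists>N. \<forall>m\<ge>N. \<forall>n\<ge>N. \<parallel>\<lambda>x. \<sigma> m x - \<sigma> n x\<parallel>\<^bsub>?L\<^esub> < e" if "0 < e" for e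
    using that \<sigma> by (simp only: Lp_fun_minus[OF assms])
  have diff: "(\<lambda>x. \<sigma> m x - \<sigma> n x) \<in> carrier ?L" for m n
    using L.minus_closed[OF \<sigma>[of m] \<sigma>[of n]] by (simp only: Lp_fun_minus[OF assms \<sigma> \<sigma>])
  obtain r where r: "strict_mono r" "AE x in M. Cauchy (\<lambda>i. \<sigma> (r i) x)"
  proof (rule cauchy_L1_AE_cauchy_subseq[of M \<sigma>])
    show "integrable M (\<sigma> n)" for n
      by (rule Lp_imp_L1[OF assms _ \<sigma>, of "\<parallel>\<sigma> n\<parallel>\<^bsub>?L\<^esub> + 1"]) (use Lp_nrm_ge_0[of p M "\<sigma> n"] in auto)
    fix e :: real assume "0 < e"
    then obtain N where "\<forall>m\<ge>N. \<forall>n\<ge>N. \<parallel>\<lambda>x. \<sigma> m x - \<sigma> n x\<parallel>\<^bsub>?L\<^esub> < e / 4"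
      using Cauchy[of "e / 4"] by auto
    then have "(\<integral>x. \<bar>\<sigma> m x - \<sigma> n x\<bar> \<partial>M) \<le> 2 * (e / 4)" if "N \<le> m" "N \<le> n" for m n
      using that \<open>0 < e\<close> by (intro Lp_imp_L1[OF assms _ diff]) (auto intro: less_imp_le)
    then show "\<exists>N. \<forall>m\<ge>N. \<forall>n\<ge>N. (\<integral>x. norm (\<sigma> m x - \<sigma> n x) \<partial>M) < e"
      using \<open>0 < e\<close> by (intro exI[of _ N]) (force simp del: times_divide_eq_right)
  qed
  define f where "f x = lim (\<lambda>i. \<sigma> (r i) x)" for x
  have [measurable]: "f \<in> borel_measurable M" unfolding f_def by measurable
  have lim: "AE x in M. (\<lambda>i. \<sigma> (r i) x) \<longlonglongrightarrow> f x"
    using r(2) by eventually_elim (simp add: f_def real_Cauchy_convergent convergent_LIMSEQ_iff[symmetric])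
  have close: "\<exists>N. \<forall>m\<ge>N. (\<lambda>x. \<sigma> m x - f x) \<in> carrier ?L \<and> \<parallel>\<lambda>x. \<sigma> m x - f x\<parallel>\<^bsub>?L\<^esub> \<le> e"
    if "0 < e" for e
  proof -
    obtain N where N: "\<forall>m\<ge>N. \<forall>n\<ge>N. \<parallel>\<lambda>x. \<sigma> m x - \<sigma> n x\<parallel>\<^bsub>?L\<^esub> < e"
      using Cauchy[OF \<open>0 < e\<close>] by blast
    have "(\<integral>\<^sup>+x. ennreal (\<bar>\<sigma> m x - f x\<bar> powr p) \<partial>M) \<le> ennreal (e powr p)" if "N \<le> m" for m
    proof -
      have "AE x in M. (\<lambda>i. ennreal (\<bar>\<sigma> m x - \<sigma> (r i) x\<bar> powr p))
          \<longlonglongrightarrow> ennreal (\<bar>\<sigma> m x - f x\<bar> powr p)"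
        using lim by eventually_elim (use assms in \<open>auto intro!: tendsto_intros\<close>)
      then have "AE x in M. ennreal (\<bar>\<sigma> m x - f x\<bar> powr p) =
          liminf (\<lambda>i. ennreal (\<bar>\<sigma> m x - \<sigma> (r i) x\<bar> powr p))"
        by eventually_elim (metis lim_imp_Liminf trivial_limit_sequentially)
      then have "(\<integral>\<^sup>+x. ennreal (\<bar>\<sigma> m x - f x\<bar> powr p) \<partial>M) =
          (\<integral>\<^sup>+x. liminf (\<lambda>i. ennreal (\<bar>\<sigma> m x - \<sigma> (r i) x\<bar> powr p)) \<partial>M)"
        by (rule nn_integral_cong_AE)
      also have "\<dots> \<le> liminf (\<lambda>i. \<integral>\<^sup>+x. ennreal (\<bar>\<sigma> m x - \<sigma> (r i) x\<bar> powr p) \<partial>M)"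
        by (rule nn_integral_liminf) measurable
      also have "\<dots> \<le> ennreal (e powr p)"
      proof (rule Liminf_le)
        have "(\<integral>\<^sup>+x. ennreal (\<bar>\<sigma> m x - \<sigma> (r i) x\<bar> powr p) \<partial>M) \<le> ennreal (e powr p)"
          if "N \<le> i" for i
        proof -
          have "N \<le> r i" using that seq_suble[OF r(1), of i] by simp
          then show ?thesis
            using Lp_nrm_le_iff[OF assms, of e "\<lambda>x. \<sigma> m x - \<sigma> (r i) x" M] diff[of m "r i"]
              N \<open>N \<le> m\<close> \<open>0 < e\<close> by (simp add: less_imp_le)
        qed
        then show "\<forall>\<^sub>F i in sequentially.
            (\<integral>\<^sup>+x. ennreal (\<bar>\<sigma> m x - \<sigma> (r i) x\<bar> powr p) \<partial>M) \<le> ennreal (e powr p)"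
          by (auto simp: eventually_sequentially)
      qed simp
      finally show ?thesis .
    qed
    then show ?thesis
      using that Lp_nrm_le_iff[OF assms, of e "\<lambda>x. \<sigma> m x - f x" M for m]
      by (intro exI[of _ N]) auto
  qed
  \<comment> \<open>\<open>f = \<sigma> N - (\<sigma> N - f)\<close> is a difference of two elements of \<open>L\<^sup>p\<close>.\<close>
  obtain N where N: "(\<lambda>x. \<sigma> N x - f x) \<in> carrier ?L" using close[of 1] by auto
  from L.minus_closed[OF \<sigma>[of N] N] have f: "f \<in> carrier ?L"
    using Lp_fun_minus[OF assms \<sigma>[of N] N] by simp
  have "(\<lambda>n. \<parallel>\<sigma> n \<ominus>\<^bsub>?L\<^esub> f\<parallel>\<^bsub>?L\<^esub>) \<longlonglongrightarrow> 0"
  proof (rule LIMSEQ_I)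
    fix e :: real assume "0 < e"
    then obtain N where "\<forall>m\<ge>N. \<parallel>\<lambda>x. \<sigma> m x - f x\<parallel>\<^bsub>?L\<^esub> \<le> e / 2"
      using close[of "e / 2"] by auto
    then show "\<exists>N. \<forall>n\<ge>N. norm (\<parallel>\<sigma> n \<ominus>\<^bsub>?L\<^esub> f\<parallel>\<^bsub>?L\<^esub> - 0) < e"
      using \<open>0 < e\<close> \<sigma> f
      by (intro exI[of _ N]) (force simp add: Lp_fun_minus[OF assms] Lp_nrm_ge_0 simp del: Lp_fun_space_simps)
  qed
  with f show "\<exists>x\<in>carrier ?L. (\<lambda>n. \<parallel>\<sigma> n \<ominus>\<^bsub>?L\<^esub> x\<parallel>\<^bsub>?L\<^esub>) \<longlonglongrightarrow> 0" by blast
qed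

lemma linear_isometry_compose_measure_preserving:
  assumes "measure_preserving M N h"
  shows "linear_isometry (Lp_fun_space p N) (Lp_fun_space p M) (\<lambda>u. u \<circ> h)"
proof -
  have h [measurable]: "h \<in> M \<rightarrow>\<^sub>M N" and N: "distr M N h = N"
    using assms by (auto simp: measure_preserving_def)
  have "integrable M (\<lambda>x. \<bar>u (h x)\<bar> powr p) \<longleftrightarrow> integrable N (\<lambda>y. \<bar>u y\<bar> powr p)"
    "(\<integral>x. \<bar>u (h x)\<bar> powr p \<partial>M) = (\<integral>y. \<bar>u y\<bar> powr p \<partial>N)"
    if [measurable]: "u \<in> borel_measurable N" for u :: "'b \<Rightarrow> real"
    using integrable_distr_eq[OF h, of "\<lambda>y. \<bar>u y\<bar> powr p"]
      integral_distr[OF h, of "\<lambda>y. \<bar>u y\<bar> powr p"] unfolding N by auto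
  then show ?thesis
    unfolding linear_isometry_def by (auto simp: Lp_fun_space_def comp_def)
qed

lemma Lp_pullback_class:
  assumes "1 \<le> p" "measure_preserving M N h" "u \<in> carrier (Lp_fun_space p N)"
  shows "Lp_pullback p M h (null_class (Lp_fun_space p N) u) =
    null_class (Lp_fun_space p M) (u \<circ> h)"
  unfolding Lp_pullback_def Lp_rel_eq_null_rel[OF assms(1)]
  by (intro UN_null_class_isometry seminormed_space_Lp_fun_space
      linear_isometry_compose_measure_preserving assms)

lemma linear_isometry_Lp_pullback:
  assumes "1 \<le> p" "measure_preserving M N h"
  shows "linear_isometry (Lp p N) (Lp p M) (Lp_pullback p M h)"
proof -
  interpret N: seminormed_space "Lp_fun_space p N" by (rule seminormed_space_Lp_fun_space[OF assms(1)])
  interpret M: seminormed_space "Lp_fun_space p M" by (rule seminormed_space_Lp_fun_space[OF assms(1)])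
  show ?thesis
    unfolding Lp_eq_null_quotient[OF assms(1)]
    by (rule N.linear_isometry_from_null_quotient
          [where f = "\<lambda>u. null_class (Lp_fun_space p M) (u \<circ> h)", OF Lp_pullback_class[OF assms]])
      (auto intro!: linear_isometry_comp[OF linear_isometry_compose_measure_preserving[OF assms(2)]
          M.linear_isometry_null_class])
qed

text \<open>The identities between the maps \<open>\<pi> i j\<close> hold on the spaces only, so the pullbacks of a
  representative need not agree as functions; they agree almost everywhere, hence as classes.\<close>

lemma ban_codiagram_Lp:
  assumes "prob_diagram I leq X \<pi>" "directed_set I leq" "1 \<le> p"
  shows "ban_codiagram I leq (\<lambda>i. Lp p (X i)) (\<lambda>i j. Lp_pullback p (X j) (\<pi> i j))"
  unfolding ban_codiagram_def
proof (intro conjI ballI impI)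
  let ?L = "\<lambda>i. Lp_fun_space p (X i)"
  have mp: "measure_preserving (X j) (X i) (\<pi> i j)" if "i \<in> I" "j \<in> I" "leq i j" for i j
    using assms(1) that unfolding prob_diagram_def by blast
  have class_eq: "null_class (?L i) u = null_class (?L i) v"
    if "u \<in> carrier (?L i)" "v \<in> carrier (?L i)" "\<And>x. x \<in> space (X i) \<Longrightarrow> u x = v x" for i u v
  proof -
    have "(u, v) \<in> Lp_rel p (X i)" using that by (auto simp: Lp_rel_def)
    then show ?thesis
      using seminormed_space.equiv_null_rel[OF seminormed_space_Lp_fun_space[OF assms(3)]]
      unfolding Lp_rel_eq_null_rel[OF assms(3)] by (rule equiv_class_eq[rotated])
  qed
  have comp: "u \<circ> \<pi> i j \<in> carrier (?L j)"
    if "i \<in> I" "j \<in> I" "leq i j" "u \<in> carrier (?L i)" for i j u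
    using linear_isometry_compose_measure_preserving[OF mp[OF that(1-3)], of p] that(4)
    unfolding linear_isometry_def by blast
  have rep: "\<exists>u\<in>carrier (?L i). z = null_class (?L i) u" if "z \<in> carrier (Lp p (X i))" for i z
    using that seminormed_space.null_quotientE[OF seminormed_space_Lp_fun_space[OF assms(3)]]
    unfolding Lp_eq_null_quotient[OF assms(3)] by metis
  fix i assume i: "i \<in> I"
  then interpret prob_space "X i" using assms(1) unfolding prob_diagram_def by blast
  show "banach_space (Lp p (X i))"
    unfolding Lp_eq_null_quotient[OF assms(3)]
    by (intro seminormed_space.seq_complete_null_quotient seminormed_space_Lp_fun_space
        Riesz_Fischer assms(3))
  show "Lp_pullback p (X i) (\<pi> i i) z = z" if "z \<in> carrier (Lp p (X i))" for z
  proof -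
    obtain u where u: "u \<in> carrier (?L i)" "z = null_class (?L i) u" using rep[OF \<open>z \<in> _\<close>] by blast
    have "leq i i" using assms(2) i by (auto simp: directed_set_def dest: reflp_onD)
    then have "null_class (?L i) (u \<circ> \<pi> i i) = null_class (?L i) u"
      using i u assms(1) by (intro class_eq comp) (auto simp: prob_diagram_def)
    then show ?thesis
      using Lp_pullback_class[OF assms(3) mp[OF i i \<open>leq i i\<close>] u(1)] u(2) by simp
  qed
  fix j assume j: "j \<in> I"
  show "linear_isometry (Lp p (X i)) (Lp p (X j)) (Lp_pullback p (X j) (\<pi> i j))" if "leq i j"
    by (rule linear_isometry_Lp_pullback[OF assms(3) mp[OF i j that]])
  fix k z assume k: "k \<in> I" "leq i j" "leq j k" and z: "z \<in> carrier (Lp p (X i))"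
  have ik: "leq i k" using assms(2) i j k unfolding directed_set_def by (blast dest: transp_onD)
  obtain u where u: "u \<in> carrier (?L i)" "z = null_class (?L i) u" using rep[OF z] by blast
  have "null_class (?L k) (u \<circ> \<pi> i k) = null_class (?L k) (u \<circ> \<pi> i j \<circ> \<pi> j k)"
    using assms(1) i j k by (intro class_eq comp ik u) (auto simp: prob_diagram_def)
  then show "Lp_pullback p (X k) (\<pi> i k) z =
      Lp_pullback p (X k) (\<pi> j k) (Lp_pullback p (X j) (\<pi> i j) z)"
    using Lp_pullback_class[OF assms(3) mp] comp i j k ik u by simp
qed

section \<open>The colimit of the spaces \<open>L\<^sup>p\<close> over a diagram of probability spaces\<close>

theorem theorem3p3:
  fixes I :: "'i set"
    and leq :: "'i \<Rightarrow> 'i \<Rightarrow> bool"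
    and X :: "'i \<Rightarrow> 'a measure"
    and \<pi> :: "'i \<Rightarrow> 'i \<Rightarrow> 'a \<Rightarrow> 'a"
    and X_inf :: "('i \<Rightarrow> 'a) measure"
    and p :: real
  assumes "directed_set I leq"
    and "prob_diagram I leq X \<pi>"
    and "diagram_limit I leq X \<pi> X_inf"
    and "1 \<le> p"
  shows "ban_colimit TYPE('w) I leq
           (\<lambda>i. Lp p (X i)) (\<lambda>i j. Lp_pullback p (X j) (\<pi> i j))
           (script_Lp p I leq X \<pi>) (script_Lp_inj p I leq X \<pi>)"
proof -
  interpret ban_directed_codiagram I leq "\<lambda>i. Lp p (X i)" "\<lambda>i j. Lp_pullback p (X j) (\<pi> i j)"
    by (rule ban_directed_codiagram.intro[OF assms(1) ban_codiagram_Lp[OF assms(2,1,4)]])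
  have family: "co_Cauchy p I leq X \<pi> = co_Cauchy_family"
    by (rule ext) (simp only: co_Cauchy_def co_Cauchy_family_def)
  have space: "co_Cauchy_space p I leq X \<pi> = family_space"
    by (simp only: co_Cauchy_space_def family_space_def family)
  have rel: "co_Cauchy_rel p I leq X \<pi> = null_rel family_space"
    by (simp only: co_Cauchy_rel_def null_rel_family_space family)
  have "script_Lp p I leq X \<pi> = null_quotient family_space"
    by (simp only: script_Lp_def space rel)
  moreover have "script_Lp_inj p I leq X \<pi> =
      (\<lambda>i z. null_class family_space (extend_family i z))"
    by (intro ext) (simp only: script_Lp_inj_def extend_family_def rel)
  ultimately show ?thesis
    by (simp only: ban_colimit_family_space)
qed

end
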